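(* Let $G$ be a finite group and let $\mathcal{C}_G$ be the set of all cyclic subgroups of $G$. For $C\in\mathcal{C}_G$ define \[ a(C)=\frac{1}{[G:C]}\sum_{\substack{B\in\mathcal{C}_G\\ C\subseteq B}}\mu_{\mathrm{cl}}([B:C]), \] where $\mu_{\mathrm{cl}}$ is the classical number-theoretic Möbius function. Then, for any $G$-cover $Y/X$ of finite connected graphs, we have \[ \kappa(X)=\prod_{C\in\mathcal{C}_G}\left(\frac{[G:C]\,\kappa(X_C)}{f_C(Y/X)}\right)^{a(C)}. \]
   Context: **Graphs.** A graph $X=(V_X,E_X,o,t,\iota)$ consists of a set $V_X$ of vertices, a set $E_X$ of (directed) edges, maps $o,t\colon E_X\to V_X$ (origin, terminus) and a fixed-point-free involution $\iota\colon e\mapsto\bar e$ of $E_X$ with $o(\bar e)=t(e)$. All graphs here are finite; loops and multiple edges are allowed, and an undirected edge is a pair $\{e,\bar e\}$. For $v\in V_X$ let $E_X^v=\{e\in E_X\mid o(e)=v\}$. For a finite connected graph $X$, $\kappa(X)$ is its number of spanning trees (of the underlying undirected multigraph). A morphism of graphs is a pair of maps on vertices and edges compatible with $o$, $t$ and $e\mapsto\bar e$. **Covers.** Let $X,Y$ be finite connected graphs. A morphism $\pi=(\pi_V,\pi_E)\colon Y\to X$ is a cover if $\pi_V,\pi_E$ are surjective and for each $w\in V_Y$ there is a positive integer $m_w(Y/X)$ (the ramification index at $w$) such that $\pi_E\colon E_Y^w\to E_X^{\pi_V(w)}$ is $m_w(Y/X)$-to-$1$ (every fiber has exactly $m_w(Y/X)$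 elements); by convention the empty map $\emptyset\to\emptyset$ is $1$-to-$1$, i.e. $m_w=1$ in that case. **$G$-covers.** For a finite group $G$, a cover $\pi\colon Y\to X$ is a $G$-cover (written $Y/X$) if $G$ acts faithfully on $Y$ by graph automorphisms, each fiber of $\pi_V$ and of $\pi_E$ is $G$-stable, $G$ acts transitively on each fiber of $\pi_V$, and $G$ acts freely and transitively on each fiber of $\pi_E$. Then $m_w(Y/X)=|\operatorname{Stab}_G(w)|$ is constant on vertex fibers; for $v\in V_X$ put $m_v(Y/X)=m_w(Y/X)$ for any $w\in\pi_V^{-1}(v)$. For a subgroup $H\subseteq G$, $X_H=H\backslash Y$ is the quotient graph (vertex set $H\backslash V_Y$, edge set $H\backslash E_Y$, induced structure maps); the natural map $Y\to X_H$ is an $H$-cover. **Ramification factor.** For a subgroup $H\subseteq G$, \[ f_H(Y/X)=\frac{\prod_{v\in V_X}m_v(Y/X)}{\prod_{x\in V_{X_H}}m_x(Y/X_H)}. \] The exponents $a(C)$ are rational numbers and the bases are positive rationals; powers are taken as positive real numbers. *)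

theory Defs
  imports
    "HOL-Algebra.Elementary_Groups"
    "HOL-Algebra.Group_Action"
    "HOL-Computational_Algebra.Squarefree"
    "Graph_Theory.Bidirected_Digraph"
    "Graph_Theory.Digraph_Component"
begin

section \<open>Graphs\<close>

text \<open>
  A graph \<open>(V, E, o, t, \<iota>)\<close> is a bidirected digraph: \<open>o\<close> is \<^const>\<open>tail\<close>, \<open>t\<close> is
  \<^const>\<open>head\<close>, and the involution \<open>\<iota>\<close> is the separate parameter \<open>arev\<close>, which
  \<^locale>\<open>bidirected_digraph\<close> requires to be the identity outside the arc set.
  \<^const>\<open>Digraph_Component.connected\<close> excludes the null graph.
\<close>

locale finite_connected_graph = bidirected_digraph G arev + fin_digraph G
  for G :: "('v, 'e) pre_digraph" and arev :: "'e \<Rightarrow> 'e" +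
  assumes connected: "Digraph_Component.connected G"

text \<open>
  The library's \<^const>\<open>Digraph_Component.tree\<close> forbids directed cycles, so it already rejects a
  single undirected edge \<open>{e, \<iota> e}\<close>.  A cycle of the underlying undirected multigraph is a directed
  cycle that does not use any undirected edge in both directions; loops are cycles.
\<close>

definition undirected_tree :: "('v, 'e) pre_digraph \<Rightarrow> ('e \<Rightarrow> 'e) \<Rightarrow> bool" where
  "undirected_tree H \<iota> \<longleftrightarrow> Digraph_Component.connected H \<and>
     \<not> (\<exists>p. pre_digraph.cycle H p \<and> (\<forall>e \<in> set p. \<iota> e \<notin> set p))"

definition undirected_spanning_tree ::
    "('v, 'e) pre_digraph \<Rightarrow> ('v, 'e) pre_digraph \<Rightarrow> ('e \<Rightarrow> 'e) \<Rightarrow> bool" where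
  "undirected_spanning_tree H X \<iota> \<longleftrightarrow>
     spanning H X \<and> \<iota> ` arcs H \<subseteq> arcs H \<and> undirected_tree H \<iota>"

text \<open>
  \<^const>\<open>spanning\<close> fixes the vertex set and the (total) functions \<^const>\<open>tail\<close> and \<^const>\<open>head\<close>,
  so spanning trees are counted by their sets of undirected edges.
\<close>

definition num_spanning_trees :: "('v, 'e) pre_digraph \<Rightarrow> ('e \<Rightarrow> 'e) \<Rightarrow> nat" where
  "num_spanning_trees X \<iota> = card {H. undirected_spanning_tree H X \<iota>}"

section \<open>Covers\<close>

definition is_ramification_index ::
    "('w, 'd) pre_digraph \<Rightarrow> ('v, 'e) pre_digraph \<Rightarrow> ('w \<Rightarrow> 'v) \<Rightarrow> ('d \<Rightarrow> 'e) \<Rightarrow> 'w \<Rightarrow> nat \<Rightarrow> bool" where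
  "is_ramification_index Y X \<pi>V \<pi>E w m \<longleftrightarrow>
     0 < m \<and>
     (\<forall>a \<in> out_arcs X (\<pi>V w). card {e \<in> out_arcs Y w. \<pi>E e = a} = m) \<and>
     (out_arcs X (\<pi>V w) = {} \<longrightarrow> m = 1)"

definition ramification_index ::
    "('w, 'd) pre_digraph \<Rightarrow> ('v, 'e) pre_digraph \<Rightarrow> ('w \<Rightarrow> 'v) \<Rightarrow> ('d \<Rightarrow> 'e) \<Rightarrow> 'w \<Rightarrow> nat" where
  "ramification_index Y X \<pi>V \<pi>E w = (THE m. is_ramification_index Y X \<pi>V \<pi>E w m)"

locale graph_cover =
  Y: finite_connected_graph Y \<iota>Y + X: finite_connected_graph X \<iota>X
  for Y :: "('w, 'd) pre_digraph" and \<iota>Y and X :: "('v, 'e) pre_digraph" and \<iota>X +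
  fixes \<pi>V :: "'w \<Rightarrow> 'v" and \<pi>E :: "'d \<Rightarrow> 'e"
  assumes surj_verts: "\<pi>V ` verts Y = verts X"
    and surj_arcs: "\<pi>E ` arcs Y = arcs X"
    and map_tail: "\<And>e. e \<in> arcs Y \<Longrightarrow> tail X (\<pi>E e) = \<pi>V (tail Y e)"
    and map_head: "\<And>e. e \<in> arcs Y \<Longrightarrow> head X (\<pi>E e) = \<pi>V (head Y e)"
    and map_arev: "\<And>e. e \<in> arcs Y \<Longrightarrow> \<iota>X (\<pi>E e) = \<pi>E (\<iota>Y e)"
    and ramification: "\<And>w. w \<in> verts Y \<Longrightarrow> \<exists>m. is_ramification_index Y X \<pi>V \<pi>E w m"

text \<open>
  Faithfulness concerns the action on the whole graph, i.e. on vertices and edges jointly.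
\<close>

locale galois_cover =
  graph_cover Y \<iota>Y X \<iota>X \<pi>V \<pi>E +
  V: group_action G "verts Y" \<phi>V + E: group_action G "arcs Y" \<phi>E
  for G :: "('g, 'm) monoid_scheme"
    and Y :: "('w, 'd) pre_digraph" and \<iota>Y and X :: "('v, 'e) pre_digraph" and \<iota>X
    and \<pi>V :: "'w \<Rightarrow> 'v" and \<pi>E :: "'d \<Rightarrow> 'e"
    and \<phi>V :: "'g \<Rightarrow> 'w \<Rightarrow> 'w" and \<phi>E :: "'g \<Rightarrow> 'd \<Rightarrow> 'd" +
  assumes act_tail: "\<And>g e. g \<in> carrier G \<Longrightarrow> e \<in> arcs Y \<Longrightarrow> tail Y (\<phi>E g e) = \<phi>V g (tail Y e)"
    and act_head: "\<And>g e. g \<in> carrier G \<Longrightarrow> e \<in> arcs Y \<Longrightarrow> head Y (\<phi>E g e) = \<phi>V g (head Y e)"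
    and act_arev: "\<And>g e. g \<in> carrier G \<Longrightarrow> e \<in> arcs Y \<Longrightarrow> \<iota>Y (\<phi>E g e) = \<phi>E g (\<iota>Y e)"
    and faithful: "inj_on (\<lambda>g. (\<phi>V g, \<phi>E g)) (carrier G)"
    and vert_fiber_stable:
      "\<And>g w. g \<in> carrier G \<Longrightarrow> w \<in> verts Y \<Longrightarrow> \<pi>V (\<phi>V g w) = \<pi>V w"
    and arc_fiber_stable:
      "\<And>g e. g \<in> carrier G \<Longrightarrow> e \<in> arcs Y \<Longrightarrow> \<pi>E (\<phi>E g e) = \<pi>E e"
    and vert_fiber_transitive:
      "\<And>w w'. w \<in> verts Y \<Longrightarrow> w' \<in> verts Y \<Longrightarrow> \<pi>V w = \<pi>V w' \<Longrightarrow> \<exists>g \<in> carrier G. \<phi>V g w = w'"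
    and arc_fiber_transitive:
      "\<And>e e'. e \<in> arcs Y \<Longrightarrow> e' \<in> arcs Y \<Longrightarrow> \<pi>E e = \<pi>E e' \<Longrightarrow> \<exists>g \<in> carrier G. \<phi>E g e = e'"
    and arc_fiber_free:
      "\<And>g e. g \<in> carrier G \<Longrightarrow> e \<in> arcs Y \<Longrightarrow> \<phi>E g e = e \<Longrightarrow> g = \<one>\<^bsub>G\<^esub>"

text \<open>
  \<open>m\<^sub>v(Y/X)\<close> for a vertex \<open>v\<close> of the base; for a Galois cover it does not depend on the chosen
  vertex above \<open>v\<close>.
\<close>

definition base_ramification_index ::
    "('w, 'd) pre_digraph \<Rightarrow> ('v, 'e) pre_digraph \<Rightarrow> ('w \<Rightarrow> 'v) \<Rightarrow> ('d \<Rightarrow> 'e) \<Rightarrow> 'v \<Rightarrow> nat" where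
  "base_ramification_index Y X \<pi>V \<pi>E v =
     ramification_index Y X \<pi>V \<pi>E (SOME w. w \<in> verts Y \<and> \<pi>V w = v)"

section \<open>Quotient graphs\<close>

text \<open>
  Vertices and edges of \<open>H\<backslash>Y\<close> are the orbits of \<open>H\<close>, viewed as the group
  \<open>G\<lparr>carrier := H\<rparr>\<close>.  By equivariance the set of origins of the edges in an
  edge orbit is again an orbit, so the induced structure maps are images.
\<close>

definition quotient_graph ::
    "('g, 'm) monoid_scheme \<Rightarrow> ('w, 'd) pre_digraph \<Rightarrow> ('g \<Rightarrow> 'w \<Rightarrow> 'w) \<Rightarrow> ('g \<Rightarrow> 'd \<Rightarrow> 'd) \<Rightarrow> 'g set \<Rightarrow>
     ('w set, 'd set) pre_digraph" where
  "quotient_graph G Y \<phi>V \<phi>E H =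
     \<lparr> verts = orbits (G\<lparr>carrier := H\<rparr>) (verts Y) \<phi>V,
       arcs = orbits (G\<lparr>carrier := H\<rparr>) (arcs Y) \<phi>E,
       tail = (\<lambda>A. tail Y ` A),
       head = (\<lambda>A. head Y ` A) \<rparr>"

definition quotient_arev ::
    "('g, 'm) monoid_scheme \<Rightarrow> ('w, 'd) pre_digraph \<Rightarrow> ('d \<Rightarrow> 'd) \<Rightarrow> ('g \<Rightarrow> 'd \<Rightarrow> 'd) \<Rightarrow> 'g set \<Rightarrow>
     'd set \<Rightarrow> 'd set" where
  "quotient_arev G Y \<iota>Y \<phi>E H A =
     (if A \<in> orbits (G\<lparr>carrier := H\<rparr>) (arcs Y) \<phi>E then \<iota>Y ` A else A)"

definition ramification_factor ::
    "('g, 'm) monoid_scheme \<Rightarrow> ('w, 'd) pre_digraph \<Rightarrow> ('v, 'e) pre_digraph \<Rightarrow>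
     ('w \<Rightarrow> 'v) \<Rightarrow> ('d \<Rightarrow> 'e) \<Rightarrow> ('g \<Rightarrow> 'w \<Rightarrow> 'w) \<Rightarrow> ('g \<Rightarrow> 'd \<Rightarrow> 'd) \<Rightarrow> 'g set \<Rightarrow> real" where
  "ramification_factor G Y X \<pi>V \<pi>E \<phi>V \<phi>E H =
     (\<Prod>v \<in> verts X. real (base_ramification_index Y X \<pi>V \<pi>E v)) /
     (\<Prod>x \<in> verts (quotient_graph G Y \<phi>V \<phi>E H).
        real (base_ramification_index Y (quotient_graph G Y \<phi>V \<phi>E H)
          (orbit (G\<lparr>carrier := H\<rparr>) \<phi>V) (orbit (G\<lparr>carrier := H\<rparr>) \<phi>E) x))"

section \<open>The exponents\<close>

definition moebius_mu :: "nat \<Rightarrow> int" where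
  "moebius_mu n = (if squarefree n then (-1) ^ card (prime_factors n) else 0)"

definition subgroup_index :: "('g, 'm) monoid_scheme \<Rightarrow> 'g set \<Rightarrow> nat" where
  "subgroup_index G H = card (rcosets\<^bsub>G\<^esub> H)"

definition cyclic_subgroups :: "('g, 'm) monoid_scheme \<Rightarrow> 'g set set" where
  "cyclic_subgroups G = {C. subgroup C G \<and> cyclic_group (G\<lparr>carrier := C\<rparr>)}"

definition cyclic_exponent :: "('g, 'm) monoid_scheme \<Rightarrow> 'g set \<Rightarrow> real" where
  "cyclic_exponent G C =
     1 / real (subgroup_index G C) *
     (\<Sum>B \<in> {B \<in> cyclic_subgroups G. C \<subseteq> B}.
        real_of_int (moebius_mu (subgroup_index (G\<lparr>carrier := B\<rparr>) C)))"

end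

theory Submission
  imports Defs "HOL-Algebra.Multiplicative_Group" "Jordan_Normal_Form.Schur_Decomposition"
begin

text \<open>
  Write \<open>A\<close> for the negated Laplacian of \<open>Y\<close> and \<open>V\<close> for the functions on its vertices.  For every
  subgroup \<open>H\<close> the restriction of \<open>A\<close> to the \<open>H\<close>-invariant functions has the matrix
  \<open>m\<^sub>x \<cdot> A\<^sub>H(x, y)\<close>, where \<open>m\<^sub>x\<close> is the ramification index and \<open>A\<^sub>H\<close> the negated Laplacian of
  \<open>X\<^sub>H\<close>.  By the matrix-tree theorem the linear coefficient of its characteristic polynomial is,
  up to sign, \<open>\<kappa>(X\<^sub>H) \<cdot> \<Prod>m\<^sub>x \<cdot> \<Sum>1/m\<^sub>x = \<kappa>(X\<^sub>H) \<cdot> \<Prod>m\<^sub>x \<cdot> |V\<^sub>Y| / |H|\<close>, so this number is the product of the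
  nonzero eigenvalues.  The power sums of the eigenvalues are the traces of \<open>A\<^sup>k\<close> on \<open>V\<^sup>H\<close>, which are
  averages over \<open>H\<close> of the traces of \<open>A\<^sup>k P\<^sub>h\<close>.  Averages over \<open>G\<close> are combinations of averages
  over the cyclic subgroups \<open>C\<close> with coefficients \<open>a(C)\<close> (Moebius inversion in each cyclic group).
  Hence the power sums, the multiplicities of every eigenvalue, and finally the logarithms of the
  products of the nonzero eigenvalues for \<open>G\<close> and for all \<open>C\<close> are related by the same combination.
\<close>

hide_const (open) up_ring.coeff up_ring.monom

section \<open>Determinants and eigenvalues\<close>

text \<open>The Leibniz formula over an arbitrary finite set lets vertex sets index matrices without
  an enumeration; \<open>det_on_eq_det\<close> links it to matrices indexed by numbers.\<close>

definition det_on :: "'a set \<Rightarrow> ('a \<Rightarrow> 'a \<Rightarrow> 'b :: comm_ring_1) \<Rightarrow> 'b" where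
  "det_on S A = (\<Sum>p | p permutes S. of_int (sign p) * (\<Prod>x\<in>S. A x (p x)))"

lemma det_on_cong:
  assumes "\<And>x y. x \<in> S \<Longrightarrow> y \<in> S \<Longrightarrow> A x y = B x y"
  shows "det_on S A = det_on S B"
  unfolding det_on_def
proof (intro sum.cong refl arg_cong2[where f = "(*)"] prod.cong)
  fix p x assume "p \<in> {p. p permutes S}" "x \<in> S"
  then show "A x (p x) = B x (p x)" using assms permutes_in_image[of p S x] by simp
qed

text \<open>Transporting permutations along \<open>b\<close> preserves signs and merely renames the
  factors, so the two Leibniz sums agree term by term.\<close>

lemma det_on_eq_det:
  assumes b: "bij_betw b {0..<n} S"
  shows "det_on S A = det (mat n n (\<lambda>(i, j). A (b i) (b j)))"
proof -
  let ?N = "{0..<n}" and ?b' = "inv_into {0..<n} b"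
  let ?m = "map_permutation {0..<n} b"
  have inj: "inj_on b ?N" and im: "b ` ?N = S" using b by (auto simp: bij_betw_def)
  have b': "bij_betw ?b' S ?N" using b by (rule bij_betw_inv_into)
  have left: "?b' (b i) = i" if "i \<in> ?N" for i using inj that by simp
  have right: "b (?b' x) = x" if "x \<in> S" for x using that im by (simp add: f_inv_into_f)
  have bij: "bij_betw ?m {p. p permutes ?N} {p. p permutes S}"
  proof (rule bij_betw_byWitness[where f' = "map_permutation S ?b'"])
    show "\<forall>p\<in>{p. p permutes ?N}. map_permutation S ?b' (?m p) = p"
      using map_permutation_compose_inv[OF b] left by blast
    show "\<forall>p\<in>{p. p permutes S}. ?m (map_permutation S ?b' p) = p"
      using map_permutation_compose_inv[OF b'] right by blast
    show "?m ` {p. p permutes ?N} \<subseteq> {p. p permutes S}"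
      using map_permutation_permutes[OF b] by blast
    show "map_permutation S ?b' ` {p. p permutes S} \<subseteq> {p. p permutes ?N}"
      using map_permutation_permutes[OF b'] by blast
  qed
  have "det_on S A = (\<Sum>p | p permutes ?N. of_int (sign (?m p)) * (\<Prod>x\<in>S. A x (?m p x)))"
    unfolding det_on_def by (rule sum.reindex_bij_betw[OF bij, symmetric])
  also have "\<dots> = (\<Sum>p | p permutes ?N. signof p * (\<Prod>i\<in>?N. A (b i) (b (p i))))"
  proof (rule sum.cong[OF refl])
    fix p assume "p \<in> {p. p permutes ?N}"
    then have p: "p permutes ?N" by simp
    have "sign (?m p) = sign p"
      using inj p by (intro sign_map_permutation) auto
    moreover have "(\<Prod>x\<in>S. A x (?m p x)) = (\<Prod>i\<in>?N. A (b i) (?m p (b i)))"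
      by (rule prod.reindex_bij_betw[OF b, symmetric])
    moreover have "\<dots> = (\<Prod>i\<in>?N. A (b i) (b (p i)))"
      by (intro prod.cong refl arg_cong2[where f = A] map_permutation_apply[OF inj])
    ultimately show "of_int (sign (?m p)) * (\<Prod>x\<in>S. A x (?m p x)) =
        signof p * (\<Prod>i\<in>?N. A (b i) (b (p i)))" by (simp add: sign_def)
  qed
  also have "\<dots> = det (mat n n (\<lambda>(i, j). A (b i) (b j)))"
  proof -
    have "p i < n" if "p permutes ?N" "i < n" for p i
      using permutes_in_image[OF that(1), of i] that(2) by simp
    then show ?thesis
      by (subst det_def'[of _ n]) (auto intro!: sum.cong prod.cong arg_cong2[where f = "(*)"])
  qed
  finally show ?thesis .
qed

text \<open>Multilinearity in all rows at once: distributing each product over its sums leaves one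
  term per choice \<open>f\<close> of a summand in every row.\<close>

lemma det_on_sum_rows:
  assumes "finite S" and "\<And>x. x \<in> S \<Longrightarrow> finite (I x)"
  shows "det_on S (\<lambda>x y. \<Sum>i\<in>I x. A x i y) = (\<Sum>f\<in>PiE S I. det_on S (\<lambda>x y. A x (f x) y))"
proof -
  have "(\<Prod>x\<in>S. \<Sum>i\<in>I x. A x i (p x)) = (\<Sum>f\<in>PiE S I. \<Prod>x\<in>S. A x (f x) (p x))" for p
    using assms by (intro prod_sum_PiE) auto
  then have "det_on S (\<lambda>x y. \<Sum>i\<in>I x. A x i y) =
      (\<Sum>p | p permutes S. \<Sum>f\<in>PiE S I. of_int (sign p) * (\<Prod>x\<in>S. A x (f x) (p x)))"
    unfolding det_on_def by (simp add: sum_distrib_left)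
  also have "\<dots> = (\<Sum>f\<in>PiE S I. det_on S (\<lambda>x y. A x (f x) y))"
    unfolding det_on_def by (rule sum.swap)
  finally show ?thesis .
qed

text \<open>Triangularity is measured by a rank. A permutation with nonzero product never raises the
  rank and lowers it at every moved point, yet permuting cannot change the total rank; so only the
  identity contributes.\<close>

lemma det_on_triangular:
  fixes A :: "'a \<Rightarrow> 'a \<Rightarrow> 'b :: idom" and rk :: "'a \<Rightarrow> nat"
  assumes "finite S"
    and tri: "\<And>x y. x \<in> S \<Longrightarrow> y \<in> S \<Longrightarrow> A x y \<noteq> 0 \<Longrightarrow> y = x \<or> rk y < rk x"
  shows "det_on S A = (\<Prod>x\<in>S. A x x)"
proof -
  have zero: "(\<Prod>x\<in>S. A x (p x)) = 0" if p: "p permutes S" "p \<noteq> id" for p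
  proof (rule ccontr)
    assume "(\<Prod>x\<in>S. A x (p x)) \<noteq> 0"
    then have nz: "A x (p x) \<noteq> 0" if "x \<in> S" for x
      using that \<open>finite S\<close> by simp
    have in_S: "p x \<in> S" if "x \<in> S" for x using p(1) that by (simp add: permutes_in_image)
    obtain x where x: "x \<in> S" "p x \<noteq> x"
      using p by (metis eq_id_iff permutes_not_in)
    have "(\<Sum>x\<in>S. rk (p x)) < (\<Sum>x\<in>S. rk x)"
    proof (rule sum_strict_mono_ex1[OF \<open>finite S\<close>])
      show "\<forall>x\<in>S. rk (p x) \<le> rk x"
        using tri[OF _ in_S nz] by (metis less_imp_le order_refl)
      show "\<exists>x\<in>S. rk (p x) < rk x" using tri[OF _ in_S nz] x by blast
    qed
    moreover have "(\<Sum>x\<in>S. rk (p x)) = (\<Sum>x\<in>S. rk x)"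
      using permutes_imp_bij[OF p(1)] by (rule sum.reindex_bij_betw)
    ultimately show False by simp
  qed
  have "det_on S A = (\<Sum>p\<in>{id}. of_int (sign p) * (\<Prod>x\<in>S. A x (p x)))"
    unfolding det_on_def
    by (rule sum.mono_neutral_right)
       (use zero finite_permutations[OF \<open>finite S\<close>] permutes_id in auto)
  then show ?thesis by simp
qed

lemma det_on_zero:
  fixes A :: "'a \<Rightarrow> 'a \<Rightarrow> 'b :: idom"
  assumes "finite S" and x: "x \<in> S" "v x \<noteq> 0"
    and ker: "\<And>x. x \<in> S \<Longrightarrow> (\<Sum>y\<in>S. A x y * v y) = 0"
  shows "det_on S A = 0"
proof -
  define n where "n = card S"
  obtain b where b: "bij_betw b {0..<n} S"
    using ex_bij_betw_nat_finite[OF \<open>finite S\<close>] unfolding n_def by blast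
  let ?M = "mat n n (\<lambda>(i, j). A (b i) (b j))" and ?v = "vec n (\<lambda>i. v (b i))"
  have im: "b ` {0..<n} = S" using b by (simp add: bij_betw_def)
  have "?M *\<^sub>v ?v = 0\<^sub>v n"
  proof (rule eq_vecI)
    fix i assume "i < dim_vec (0\<^sub>v n :: 'b vec)"
    then have i: "i < n" by simp
    then have "(?M *\<^sub>v ?v) $ i = (\<Sum>j\<in>{0..<n}. A (b i) (b j) * v (b j))"
      by (simp add: scalar_prod_def)
    also have "\<dots> = (\<Sum>y\<in>S. A (b i) y * v y)" by (rule sum.reindex_bij_betw[OF b])
    also have "\<dots> = 0" using ker im i by force
    finally show "(?M *\<^sub>v ?v) $ i = 0\<^sub>v n $ i" using i by simp
  qed simp
  moreover have "?v \<noteq> 0\<^sub>v n"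
  proof -
    obtain i where "i < n" "b i = x" using x im by auto
    then show ?thesis using x by (metis index_vec index_zero_vec(1))
  qed
  ultimately have "det ?M = 0"
    using det_0_iff_vec_prod_zero[of ?M n] by (metis mat_carrier vec_carrier)
  then show ?thesis by (simp add: det_on_eq_det[OF b])
qed

text \<open>The values of \<open>g\<close> on \<open>R\<close> are irrelevant: only the first visit to \<open>R\<close> matters.\<close>

definition leads_to :: "'a set \<Rightarrow> ('a \<Rightarrow> 'a) \<Rightarrow> 'a \<Rightarrow> bool" where
  "leads_to R g x \<longleftrightarrow> (\<exists>k. (g ^^ k) x \<in> R)"

text \<open>The depth of \<open>x\<close> below the roots, used as the rank for triangularity and
  for inductions along in-trees. It is meaningful only if \<open>leads_to\<close> holds.\<close>

definition steps_to :: "'a set \<Rightarrow> ('a \<Rightarrow> 'a) \<Rightarrow> 'a \<Rightarrow> nat" where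
  "steps_to R g x = (LEAST k. (g ^^ k) x \<in> R)"

lemma leads_to_base: "x \<in> R \<Longrightarrow> leads_to R g x"
  unfolding leads_to_def by (metis funpow_0)

lemma leads_to_step:
  assumes "x \<notin> R" shows "leads_to R g (g x) \<longleftrightarrow> leads_to R g x"
proof
  assume "leads_to R g (g x)"
  then obtain k where "(g ^^ k) (g x) \<in> R" by (auto simp: leads_to_def)
  then have "(g ^^ Suc k) x \<in> R" by (simp only: funpow_Suc_right o_apply)
  then show "leads_to R g x" unfolding leads_to_def by blast
next
  assume "leads_to R g x"
  then obtain k where k: "(g ^^ k) x \<in> R" by (auto simp: leads_to_def)
  with assms obtain j where "k = Suc j" by (cases k) auto
  with k have "(g ^^ j) (g x) \<in> R" by (simp only: funpow_Suc_right o_apply)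
  then show "leads_to R g (g x)" unfolding leads_to_def by blast
qed

lemma steps_to_step:
  assumes "x \<notin> R" "leads_to R g x"
  shows "steps_to R g x = Suc (steps_to R g (g x))"
proof -
  obtain k where "(g ^^ k) x \<in> R" using assms(2) by (auto simp: leads_to_def)
  then have "(LEAST k. (g ^^ k) x \<in> R) = Suc (LEAST k. (g ^^ Suc k) x \<in> R)"
    by (rule Least_Suc) (use assms in simp)
  then show ?thesis unfolding steps_to_def by (simp only: funpow_Suc_right o_apply)
qed

lemma leads_toI_rank:
  fixes rk :: "'a \<Rightarrow> nat"
  assumes "x \<in> S" and "\<And>x. x \<in> S - R \<Longrightarrow> g x \<in> S \<and> rk (g x) < rk x"
  shows "leads_to R g x"
  using assms(1)
proof (induction "rk x" arbitrary: x rule: less_induct)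
  case less
  show ?case
  proof (cases "x \<in> R")
    case False
    then have "leads_to R g (g x)" using less assms(2) by blast
    then show ?thesis using leads_to_step[OF False] by blast
  qed (rule leads_to_base)
qed

text \<open>Every non-root row is a weighted edge vector from \<open>x\<close> to
  \<open>g x\<close>. If all points flow into \<open>R\<close>, then \<open>g\<close> strictly
  lowers \<open>steps_to\<close>, so the matrix is triangular and nothing cancels on its diagonal;
  otherwise it has a kernel.\<close>

lemma det_on_functional_graph:
  fixes d c :: "'a \<Rightarrow> 'b :: idom"
  assumes "finite S" "R \<subseteq> S" and g: "\<And>x. x \<in> S - R \<Longrightarrow> g x \<in> S"
  shows "det_on S (\<lambda>x y. if x \<in> R then d x * of_bool (x = y)
      else c x * (of_bool (x = y) - of_bool (g x = y))) =
    (if \<forall>x\<in>S. leads_to R g x then (\<Prod>x\<in>R. d x) * (\<Prod>x\<in>S - R. c x) else 0)"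
    (is "det_on S ?A = _")
proof (cases "\<forall>x\<in>S. leads_to R g x")
  case True
  let ?rk = "steps_to R g"
  have rk: "?rk (g x) < ?rk x" if "x \<in> S - R" for x
    using steps_to_step[of x R g] True that by auto
  have "det_on S ?A = (\<Prod>x\<in>S. ?A x x)"
    by (rule det_on_triangular[where rk = ?rk])
       (use rk \<open>finite S\<close> in \<open>auto simp: of_bool_def split: if_splits\<close>)
  also have "\<dots> = (\<Prod>x\<in>S. if x \<in> R then d x else c x)"
    using rk by (intro prod.cong) (force simp: of_bool_def)+
  also have "\<dots> = (\<Prod>x\<in>R. d x) * (\<Prod>x\<in>S - R. c x)"
    using \<open>finite S\<close> \<open>R \<subseteq> S\<close>
    by (subst prod.subset_diff[OF \<open>R \<subseteq> S\<close> \<open>finite S\<close>]) (simp add: Int_absorb1 mult.commute)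
  finally show ?thesis using True by simp
next
  case False
  then obtain x where x: "x \<in> S" "\<not> leads_to R g x" by blast
  \<comment> \<open>The indicator of the points that never reach \<open>R\<close> vanishes on
    \<open>R\<close> and is constant along \<open>g\<close> outside \<open>R\<close>, so every row
    annihilates it.\<close>
  let ?v = "\<lambda>x. of_bool (\<not> leads_to R g x) :: 'b"
  have "det_on S ?A = 0"
  proof (rule det_on_zero[OF \<open>finite S\<close> x(1)])
    show "?v x \<noteq> 0" using x by simp
    fix z assume z: "z \<in> S"
    have delta: "(\<Sum>y\<in>S. of_bool (u = y) * ?v y) = ?v u" if "u \<in> S" for u
      using that \<open>finite S\<close> by (subst sum.remove[of _ u]) (auto intro!: sum.neutral)
    show "(\<Sum>y\<in>S. ?A z y * ?v y) = 0"
    proof (cases "z \<in> R")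
      case True
      have "(\<Sum>y\<in>S. ?A z y * ?v y) = d z * (\<Sum>y\<in>S. of_bool (z = y) * ?v y)"
        using True by (simp add: sum_distrib_left mult.assoc)
      then show ?thesis using delta[OF z] True leads_to_base[of z R g] by simp
    next
      case False
      have "(\<Sum>y\<in>S. ?A z y * ?v y) =
          c z * ((\<Sum>y\<in>S. of_bool (z = y) * ?v y) - (\<Sum>y\<in>S. of_bool (g z = y) * ?v y))"
        using False
        by (simp only: if_False sum_subtractf[symmetric] sum_distrib_left left_diff_distrib mult.assoc)
      then show ?thesis using delta[OF z] delta[of "g z"] g z False leads_to_step[OF False, of g]
        by simp
    qed
  qed
  then show ?thesis using False by (simp only: if_False)
qed

section \<open>Traces of matrix powers and eigenvalue lists\<close>

fun mpow :: "'a set \<Rightarrow> ('a \<Rightarrow> 'a \<Rightarrow> 'b :: comm_semiring_1) \<Rightarrow> nat \<Rightarrow> 'a \<Rightarrow> 'a \<Rightarrow> 'b" where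
  "mpow S A 0 x y = of_bool (x = y)"
| "mpow S A (Suc k) x y = (\<Sum>z\<in>S. mpow S A k x z * A z y)"

lemma upper_triangular_mult:
  fixes A B :: "'a :: comm_ring_1 mat"
  assumes A: "A \<in> carrier_mat n n" "upper_triangular A"
    and B: "B \<in> carrier_mat n n" "upper_triangular B"
  shows "upper_triangular (A * B)" and "i < n \<Longrightarrow> (A * B) $$ (i, i) = A $$ (i, i) * B $$ (i, i)"
proof -
  have entry: "(A * B) $$ (i, j) = (\<Sum>l\<in>{0..<n}. A $$ (i, l) * B $$ (l, j))" if "i < n" "j < n" for i j
    using A B that by (simp add: scalar_prod_def)
  have zero: "A $$ (i, l) * B $$ (l, j) = 0" if "i < n" "l < n" "j \<le> i" "l \<noteq> i \<or> j < i" for i j l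
  proof (cases "l < i")
    case True
    then show ?thesis using A upper_triangularD[of A l i] that by auto
  next
    case False
    then have "j < l" using that by auto
    then show ?thesis using B upper_triangularD[of B j l] that by auto
  qed
  show "upper_triangular (A * B)"
  proof
    fix i j assume "j < i" "i < dim_row (A * B)"
    then show "(A * B) $$ (i, j) = 0"
      using A entry[of i j] zero by (auto intro!: sum.neutral)
  qed
  show "(A * B) $$ (i, i) = A $$ (i, i) * B $$ (i, i)" if "i < n"
    using that zero[of i _ i] by (simp add: entry sum.remove[of "{0..<n}" i] sum.neutral)
qed

lemma upper_triangular_pow:
  fixes A :: "'a :: comm_ring_1 mat"
  assumes A: "A \<in> carrier_mat n n" "upper_triangular A"
  shows "upper_triangular (A ^\<^sub>m k) \<and> (\<forall>i<n. (A ^\<^sub>m k) $$ (i, i) = A $$ (i, i) ^ k)"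
proof (induction k)
  case 0
  then show ?case using A by auto
next
  case (Suc k)
  then show ?case using upper_triangular_mult[OF pow_carrier_mat[OF A(1)] _ A, of k]
    by (auto simp: mult.commute)
qed

lemma trace_mult_comm:
  fixes A B :: "'a :: comm_ring_1 mat"
  assumes "A \<in> carrier_mat n n" "B \<in> carrier_mat n n"
  shows "(\<Sum>i<n. (A * B) $$ (i, i)) = (\<Sum>i<n. (B * A) $$ (i, i))"
proof -
  have "(\<Sum>i<n. (A * B) $$ (i, i)) = (\<Sum>i<n. \<Sum>j<n. A $$ (i, j) * B $$ (j, i))"
    using assms by (simp add: scalar_prod_def atLeast0LessThan)
  also have "\<dots> = (\<Sum>j<n. \<Sum>i<n. B $$ (j, i) * A $$ (i, j))"
    by (subst sum.swap) (simp add: mult.commute)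
  also have "\<dots> = (\<Sum>j<n. (B * A) $$ (j, j))"
    using assms by (simp add: scalar_prod_def atLeast0LessThan)
  finally show ?thesis .
qed

text \<open>The Schur decomposition gives a similar triangular matrix \<open>B\<close> with diagonal
  \<open>es\<close>. Conjugation cancels in the trace, and the diagonal of a power of
  \<open>B\<close> consists of the powers of its entries.\<close>

lemma trace_pow_eq_power_sum:
  fixes A :: "complex mat"
  assumes A: "A \<in> carrier_mat n n" and cp: "char_poly A = (\<Prod>e\<leftarrow>es. [:- e, 1:])"
  shows "(\<Sum>i<n. (A ^\<^sub>m k) $$ (i, i)) = (\<Sum>e\<leftarrow>es. e ^ k)"
proof -
  obtain B P Q where "schur_decomposition A es = (B, P, Q)" by (cases "schur_decomposition A es") auto
  from schur_decomposition[OF A cp this]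
  have sim: "similar_mat_wit A B P Q" and ut: "upper_triangular B" and diag: "diag_mat B = es" by auto
  note carr = similar_mat_witD2[OF A sim]
  have B: "B ^\<^sub>m k \<in> carrier_mat n n" using carr by auto
  have "(\<Sum>i<n. (A ^\<^sub>m k) $$ (i, i)) = (\<Sum>i<n. ((P * B ^\<^sub>m k) * Q) $$ (i, i))"
    by (simp only: similar_mat_wit_pow_id[OF sim])
  also have "\<dots> = (\<Sum>i<n. (Q * (P * B ^\<^sub>m k)) $$ (i, i))"
    using carr B by (intro trace_mult_comm) auto
  also have "Q * (P * B ^\<^sub>m k) = B ^\<^sub>m k"
    using carr(2) B left_mult_one_mat[OF B]
    by (simp add: assoc_mult_mat[OF carr(7) carr(6) B, symmetric])
  also have "(\<Sum>i<n. (B ^\<^sub>m k) $$ (i, i)) = (\<Sum>i<n. (B $$ (i, i)) ^ k)"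
    using upper_triangular_pow[of B n k] carr ut by simp
  also have "\<dots> = (\<Sum>e\<leftarrow>es. e ^ k)"
    using carr(5) unfolding diag[symmetric] diag_mat_def
    by (simp add: comp_def interv_sum_list_conv_sum_set_nat atLeast0LessThan)
  finally show ?thesis .
qed

text \<open>One list with multiplicities serves both halves of the argument: the coefficients of the
  characteristic polynomial, which count trees, and the traces of powers, which are group
  averages.\<close>

lemma eigenvalue_list:
  fixes A :: "'a \<Rightarrow> 'a \<Rightarrow> complex"
  assumes "finite S"
  obtains es where
    "det_on S (\<lambda>x y. of_bool (x = y) * [:0, 1:] - [:A x y:]) = (\<Prod>e\<leftarrow>es. [:- e, 1:])"
    and "\<And>k. (\<Sum>x\<in>S. mpow S A k x x) = (\<Sum>e\<leftarrow>es. e ^ k)"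
proof -
  define n where "n = card S"
  obtain b where b: "bij_betw b {0..<n} S"
    using ex_bij_betw_nat_finite[OF \<open>finite S\<close>] unfolding n_def by blast
  let ?M = "mat n n (\<lambda>(i, j). A (b i) (b j))"
  have M: "?M \<in> carrier_mat n n" by simp
  obtain es where es: "char_poly ?M = (\<Prod>e\<leftarrow>es. [:- e, 1:])"
    using char_poly_factorized[OF M] by blast
  have inj: "b i = b j \<longleftrightarrow> i = j" if "i < n" "j < n" for i j
    using b that by (auto simp: bij_betw_def inj_on_def)
  have char: "char_poly ?M = det_on S (\<lambda>x y. of_bool (x = y) * [:0, 1:] - [:A x y:])"
    unfolding det_on_eq_det[OF b] char_poly_def char_poly_matrix_def
    by (intro arg_cong[where f = det] eq_matI) (auto simp: inj)
  have pow: "(?M ^\<^sub>m k) $$ (i, j) = mpow S A k (b i) (b j)" if "i < n" "j < n" for i j k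
    using that
  proof (induction k arbitrary: j)
    case 0
    then show ?case by (simp add: inj)
  next
    case (Suc k)
    have "(?M ^\<^sub>m Suc k) $$ (i, j) = (\<Sum>l\<in>{0..<n}. (?M ^\<^sub>m k) $$ (i, l) * A (b l) (b j))"
      using Suc.prems by (simp add: scalar_prod_def)
    also have "\<dots> = (\<Sum>l\<in>{0..<n}. mpow S A k (b i) (b l) * A (b l) (b j))"
      using Suc by simp
    also have "\<dots> = (\<Sum>z\<in>S. mpow S A k (b i) z * A z (b j))"
      by (rule sum.reindex_bij_betw[OF b])
    finally show ?case by simp
  qed
  have "(\<Sum>x\<in>S. mpow S A k x x) = (\<Sum>e\<leftarrow>es. e ^ k)" for k
  proof -
    have "(\<Sum>x\<in>S. mpow S A k x x) = (\<Sum>i\<in>{0..<n}. mpow S A k (b i) (b i))"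
      by (rule sum.reindex_bij_betw[OF b, symmetric])
    also have "\<dots> = (\<Sum>i<n. (?M ^\<^sub>m k) $$ (i, i))"
      using pow by (simp add: atLeast0LessThan)
    finally show ?thesis using trace_pow_eq_power_sum[OF M es] by simp
  qed
  from that[OF char[symmetric, unfolded es] this] show thesis .
qed

text \<open>Up to the first visit to \<open>R\<close> the two orbits coincide. Agreement only on
  \<open>S - R\<close> matters because the encodings of in-trees carry junk values at the
  root.\<close>

lemma leads_to_cong:
  assumes "x \<in> S" and g: "\<And>x. x \<in> S - R \<Longrightarrow> g x \<in> S \<and> g x = g' x"
  shows "leads_to R g x \<longleftrightarrow> leads_to R g' x"
proof -
  have *: "leads_to R h' x" if "(h ^^ k) x \<in> R" "x \<in> S" "\<And>x. x \<in> S - R \<Longrightarrow> h x \<in> S \<and> h x = h' x"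
    for h h' :: "'a \<Rightarrow> 'a" and k x
    using that(1,2)
  proof (induction k arbitrary: x)
    case 0
    then show ?case by (simp add: leads_to_base)
  next
    case (Suc k)
    show ?case
    proof (cases "x \<in> R")
      case False
      have "(h ^^ k) (h x) \<in> R" using Suc.prems(1) by (simp only: funpow_Suc_right o_apply)
      then have "leads_to R h' (h x)" using Suc.IH that(3)[of x] Suc.prems(2) False by blast
      then show ?thesis using leads_to_step[OF False, of h'] that(3)[of x] Suc.prems(2) False by simp
    qed (rule leads_to_base)
  qed
  show ?thesis
  proof
    assume "leads_to R g x"
    then obtain k where "(g ^^ k) x \<in> R" by (auto simp: leads_to_def)
    then show "leads_to R g' x" using *[where h = g and h' = g' and k = k and x = x] assms by blast
  next
    assume "leads_to R g' x"
    then obtain k where "(g' ^^ k) x \<in> R" by (auto simp: leads_to_def)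
    moreover have "g' x \<in> S \<and> g' x = g x" if "x \<in> S - R" for x using g[OF that] by auto
    ultimately show "leads_to R g x" using *[where h = g' and h' = g and k = k and x = x] assms(1) by blast
  qed
qed

section \<open>From power sums to the product of the nonzero eigenvalues\<close>

text \<open>Linearity extends the vanishing from powers of \<open>z\<close> to all polynomials
  \<open>p\<close> in \<open>z\<close>; the Lagrange-type \<open>p\<close> that vanishes on
  \<open>L\<close> except at \<open>l\<close> isolates \<open>c l\<close>.\<close>

lemma power_sums_zero:
  fixes c :: "'a :: field \<Rightarrow> 'a"
  assumes "finite L" "l \<in> L" and sums: "\<And>k. (\<Sum>z\<in>L. c z * z ^ k) = 0"
  shows "c l = 0"
proof -
  have zero: "(\<Sum>z\<in>L. c z * poly p z) = 0" for p
  proof -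
    have "(\<Sum>z\<in>L. c z * poly p z) = (\<Sum>z\<in>L. \<Sum>i\<le>degree p. coeff p i * (c z * z ^ i))"
      by (simp add: poly_altdef sum_distrib_left algebra_simps)
    also have "\<dots> = (\<Sum>i\<le>degree p. coeff p i * (\<Sum>z\<in>L. c z * z ^ i))"
      by (subst sum.swap) (simp add: sum_distrib_left)
    finally show ?thesis by (simp add: sums)
  qed
  define p where "p = (\<Prod>m\<in>L - {l}. [:- m, 1:])"
  have "poly p z = 0" if "z \<in> L - {l}" for z
    using that \<open>finite L\<close> unfolding p_def by (auto simp: poly_prod)
  then have "(\<Sum>z\<in>L. c z * poly p z) = c l * poly p l"
    using assms(1,2) by (subst sum.remove[of _ l]) (auto intro!: sum.neutral)
  moreover have "poly p l \<noteq> 0"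
    using \<open>finite L\<close> unfolding p_def by (auto simp: poly_prod)
  ultimately show ?thesis using zero[of p] by simp
qed

lemma sum_list_eq_sum_count:
  fixes f :: "'a \<Rightarrow> 'b :: comm_semiring_1"
  assumes "finite L" "set es \<subseteq> L"
  shows "(\<Sum>e\<leftarrow>es. f e) = (\<Sum>z\<in>L. of_nat (count_list es z) * f z)"
  using assms(2)
proof (induction es)
  case (Cons e es)
  have "(\<Sum>z\<in>L. of_nat (count_list (e # es) z) * f z) =
      (\<Sum>z\<in>L. of_bool (e = z) * f z + of_nat (count_list es z) * f z)"
    by (intro sum.cong refl) (auto simp: algebra_simps)
  also have "\<dots> = (\<Sum>z\<in>L. of_bool (e = z) * f z) + (\<Sum>z\<in>L. of_nat (count_list es z) * f z)"
    by (rule sum.distrib)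
  also have "(\<Sum>z\<in>L. of_bool (e = z) * f z) = f e"
    using Cons.prems \<open>finite L\<close> by (subst sum.remove[of _ e]) (auto intro!: sum.neutral)
  finally show ?case using Cons by simp
qed simp

text \<open>The absolute value of the pseudo-determinant. Dropping zeros and taking norms makes it
  positive, so that logarithms and real powers apply.\<close>

definition nonzero_norm_prod :: "complex list \<Rightarrow> real" where
  "nonzero_norm_prod es = (\<Prod>e\<leftarrow>filter (\<lambda>e. e \<noteq> 0) es. norm e)"

lemma nonzero_norm_prod_pos: "nonzero_norm_prod es > 0"
  unfolding nonzero_norm_prod_def by (induction es) auto

lemma ln_nonzero_norm_prod:
  assumes "finite L" "set es \<subseteq> L"
  shows "ln (nonzero_norm_prod es) = (\<Sum>z\<in>L. real (count_list es z) * ln (norm z))"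
proof -
  \<comment> \<open>the zero eigenvalues drop out on the right because \<open>ln 0 = 0\<close>\<close>
  have "ln (nonzero_norm_prod es) = (\<Sum>e\<leftarrow>es. ln (norm e))"
  proof (induction es)
    case (Cons e es)
    have "nonzero_norm_prod (e # es) = (if e = 0 then 1 else norm e) * nonzero_norm_prod es"
      by (simp add: nonzero_norm_prod_def)
    then show ?case using Cons nonzero_norm_prod_pos[of es] by (simp add: ln_mult)
  qed (simp add: nonzero_norm_prod_def)
  then show ?thesis using sum_list_eq_sum_count[OF assms, of "\<lambda>z. ln (norm z)"] by simp
qed

text \<open>A linear relation between all power sums forces the same relation between the
  multiplicities of each single eigenvalue, and hence between the sums of logarithms.\<close>

lemma nonzero_norm_prod_powr:
  fixes a :: "'i \<Rightarrow> real" and es :: "'i \<Rightarrow> complex list"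
  assumes "finite I"
    and sums: "\<And>k. (\<Sum>e\<leftarrow>es0. e ^ k) = (\<Sum>i\<in>I. of_real (a i) * (\<Sum>e\<leftarrow>es i. e ^ k))"
  shows "nonzero_norm_prod es0 = (\<Prod>i\<in>I. nonzero_norm_prod (es i) powr a i)"
proof -
  define L where "L = set es0 \<union> (\<Union>i\<in>I. set (es i))"
  have L: "finite L" "set es0 \<subseteq> L" "\<And>i. i \<in> I \<Longrightarrow> set (es i) \<subseteq> L"
    using \<open>finite I\<close> by (auto simp: L_def)
  \<comment> \<open>The defect of the multiplicity relation at \<open>z\<close>. Its weighted power
    sums over \<open>L\<close> vanish, so \<open>power_sums_zero\<close> applies.\<close>
  define c where "c z = real (count_list es0 z) - (\<Sum>i\<in>I. a i * real (count_list (es i) z))" for z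
  have "(\<Sum>z\<in>L. of_real (c z) * z ^ k) = 0" for k
  proof -
    have "(\<Sum>e\<leftarrow>es0. e ^ k) = (\<Sum>z\<in>L. of_nat (count_list es0 z) * z ^ k)"
      by (rule sum_list_eq_sum_count[OF L(1,2)])
    moreover have "(\<Sum>i\<in>I. of_real (a i) * (\<Sum>e\<leftarrow>es i. e ^ k)) =
        (\<Sum>i\<in>I. \<Sum>z\<in>L. of_real (a i) * of_nat (count_list (es i) z) * z ^ k)"
      using sum_list_eq_sum_count[OF L(1) L(3), of _ "\<lambda>e. e ^ k"]
      by (intro sum.cong refl) (simp add: sum_distrib_left mult.assoc)
    moreover have "\<dots> = (\<Sum>z\<in>L. (\<Sum>i\<in>I. of_real (a i) * of_nat (count_list (es i) z)) * z ^ k)"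
      by (subst sum.swap) (simp add: sum_distrib_right)
    ultimately show ?thesis using sums[of k]
      by (simp add: c_def left_diff_distrib sum_subtractf)
  qed
  then have c0: "c z = 0" if "z \<in> L" for z
    using power_sums_zero[OF L(1) that, of "\<lambda>z. of_real (c z)"] by simp
  have "ln (nonzero_norm_prod es0) = (\<Sum>z\<in>L. \<Sum>i\<in>I. a i * real (count_list (es i) z) * ln (norm z))"
    using c0 by (subst ln_nonzero_norm_prod[OF L(1,2)]) (simp add: c_def sum_distrib_right)
  also have "\<dots> = (\<Sum>i\<in>I. a i * ln (nonzero_norm_prod (es i)))"
    using ln_nonzero_norm_prod[OF L(1) L(3)]
    by (subst sum.swap) (simp add: sum_distrib_left mult.assoc)
  also have "\<dots> = ln (\<Prod>i\<in>I. nonzero_norm_prod (es i) powr a i)"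
    using nonzero_norm_prod_pos \<open>finite I\<close>
    by (subst ln_prod) (auto simp: ln_powr less_imp_neq[symmetric])
  finally show ?thesis
    using nonzero_norm_prod_pos by (subst (asm) ln_inj_iff) (auto intro!: prod_pos simp: less_imp_neq[symmetric])
qed

text \<open>The vanishing constant term supplies a root 0. After one linear factor is split off, the
  linear coefficient is the product of \<open>- e\<close> over the remaining list; being nonzero, it
  shows that 0 occurs only once.\<close>

lemma nonzero_norm_prod_eq_coeff:
  assumes p: "p = (\<Prod>e\<leftarrow>es. [:- e, 1:])" and "coeff p 0 = 0" "coeff p 1 \<noteq> 0"
  shows "nonzero_norm_prod es = norm (coeff p 1)"
proof -
  have "(\<Prod>e\<leftarrow>es. - e) = 0"
    using assms(2) unfolding p by (induction es) (auto simp: coeff_mult_0)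
  then have "0 \<in> set es" by (auto simp: prod_list_zero_iff)
  then obtain xs ys where es: "es = xs @ 0 # ys" by (auto simp: in_set_conv_decomp)
  define q where "q = (\<Prod>e\<leftarrow>xs @ ys. [:- e, 1:])"
  have "p = [:0, 1:] * q" unfolding p es q_def by (simp add: algebra_simps)
  then have "coeff p 1 = coeff q 0" by simp
  also have "\<dots> = (\<Prod>e\<leftarrow>xs @ ys. - e)"
  proof -
    have "coeff (\<Prod>e\<leftarrow>zs. [:- e, 1:]) 0 = (\<Prod>e\<leftarrow>zs. - e)" for zs :: "complex list"
      by (induction zs) (auto simp: coeff_mult_0)
    then show ?thesis unfolding q_def .
  qed
  finally have c: "coeff p 1 = (\<Prod>e\<leftarrow>xs @ ys. - e)" .
  with assms(3) have "e \<noteq> 0" if "e \<in> set (xs @ ys)" for e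
    using that by (auto simp: prod_list_zero_iff)
  then have "filter (\<lambda>e. e \<noteq> 0) (xs @ ys) = xs @ ys" by (intro filter_True) blast
  then have "filter (\<lambda>e. e \<noteq> 0) es = xs @ ys" unfolding es by simp
  moreover have "norm (\<Prod>e\<leftarrow>zs. - e) = (\<Prod>e\<leftarrow>zs. norm e)" for zs :: "complex list"
    by (induction zs) (auto simp: norm_mult)
  ultimately show ?thesis unfolding nonzero_norm_prod_def c by (simp only:)
qed

section \<open>The matrix-tree theorem\<close>

text \<open>Spanning trees directed towards \<open>r\<close>, stored as the choice of an outgoing
  arc at every other vertex; choosing arcs instead of neighbours keeps parallel edges apart. At
  \<open>r\<close> itself \<open>f\<close> is undefined, and \<open>leads_to\<close> ignores that
  value.\<close>

definition arborescences :: "('v, 'e) pre_digraph \<Rightarrow> 'v \<Rightarrow> ('v \<Rightarrow> 'e) set" where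
  "arborescences X r = {f \<in> PiE (verts X - {r}) (out_arcs X).
     \<forall>x\<in>verts X. leads_to {r} (\<lambda>x. head X (f x)) x}"

context fin_digraph
begin

lemma finite_arborescences: "finite (arborescences G r)"
proof (rule finite_subset)
  show "arborescences G r \<subseteq> PiE (verts G - {r}) (out_arcs G)"
    unfolding arborescences_def by blast
  show "finite (PiE (verts G - {r}) (out_arcs G))"
    by (rule finite_PiE) (use finite_verts finite_out_arcs in blast)+
qed

text \<open>The forest form of the weighted matrix-tree theorem. A choice \<open>f\<close> declares
  each vertex a root (\<open>None\<close>) or gives it an outgoing arc; by
  \<open>det_on_functional_graph\<close> only the choices forming in-forests survive.\<close>

lemma laplacian_char_poly_expansion:
  fixes m :: "'a \<Rightarrow> complex"
  defines "roots f \<equiv> {x \<in> verts G. f x = None}"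
    and "I x \<equiv> insert None (Some ` out_arcs G x)"
  shows "det_on (verts G) (\<lambda>x y. of_bool (x = y) * [:0, 1:] -
      [:m x * (\<Sum>a\<in>out_arcs G x. of_bool (head G a = y) - of_bool (x = y)):]) =
    (\<Sum>f\<in>PiE (verts G) I. if \<forall>x\<in>verts G. leads_to (roots f) (\<lambda>x. head G (the (f x))) x
       then monom (\<Prod>x\<in>verts G - roots f. m x) (card (roots f)) else 0)"
proof -
  let ?V = "verts G"
  \<comment> \<open>Splits row \<open>x\<close> of the characteristic matrix: \<open>None\<close>
    carries the indeterminate on the diagonal, and each arc carries a weighted edge vector, which is
    zero for a loop.\<close>
  define A where "A x i y = (case i of None \<Rightarrow> [:0, 1:] * of_bool (x = y)
    | Some a \<Rightarrow> [:m x:] * (of_bool (x = y) - of_bool (head G a = y)))" for x i y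
  have row: "of_bool (x = y) * [:0, 1:] -
      [:m x * (\<Sum>a\<in>out_arcs G x. of_bool (head G a = y) - of_bool (x = y)):] = (\<Sum>i\<in>I x. A x i y)"
    if "x \<in> ?V" for x y
  proof -
    have fin: "finite (out_arcs G x)" by (rule finite_out_arcs)
    have hom: "[:\<Sum>a\<in>T. h a:] = (\<Sum>a\<in>T. [:h a:])" for h :: "'b \<Rightarrow> complex" and T
      by (simp add: poly_eq_iff coeff_sum coeff_pCons split: nat.split)
    have "(\<Sum>i\<in>I x. A x i y) = A x None y + (\<Sum>a\<in>out_arcs G x. A x (Some a) y)"
      unfolding I_def by (subst sum.insert) (simp_all add: fin image_iff sum.reindex)
    also have "(\<Sum>a\<in>out_arcs G x. A x (Some a) y) =
        (\<Sum>a\<in>out_arcs G x. [:m x * (of_bool (x = y) - of_bool (head G a = y)):])"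
      by (intro sum.cong refl) (auto simp: A_def)
    also have "\<dots> = [:\<Sum>a\<in>out_arcs G x. m x * (of_bool (x = y) - of_bool (head G a = y)):]"
      by (rule hom[symmetric])
    also have "(\<Sum>a\<in>out_arcs G x. m x * (of_bool (x = y) - of_bool (head G a = y))) =
        - (m x * (\<Sum>a\<in>out_arcs G x. of_bool (head G a = y) - of_bool (x = y)))"
      by (simp add: sum_distrib_left sum_negf[symmetric] algebra_simps)
    finally show ?thesis by (simp add: A_def mult.commute)
  qed
  have entry: "det_on ?V (\<lambda>x y. A x (f x) y) =
      (if \<forall>x\<in>?V. leads_to (roots f) (\<lambda>x. head G (the (f x))) x
       then monom (\<Prod>x\<in>?V - roots f. m x) (card (roots f)) else 0)" if f: "f \<in> PiE ?V I" for f
  proof -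
    let ?g = "\<lambda>x. head G (the (f x))"
    have R: "roots f \<subseteq> ?V" by (auto simp: roots_def)
    have "det_on ?V (\<lambda>x y. A x (f x) y) = det_on ?V (\<lambda>x y. if x \<in> roots f then [:0, 1:] * of_bool (x = y)
        else [:m x:] * (of_bool (x = y) - of_bool (?g x = y)))"
      by (rule det_on_cong) (auto simp: A_def roots_def split: option.split)
    also have "\<dots> = (if \<forall>x\<in>?V. leads_to (roots f) ?g x
        then (\<Prod>x\<in>roots f. [:0, 1:]) * (\<Prod>x\<in>?V - roots f. [:m x:]) else 0)"
    proof (rule det_on_functional_graph[OF finite_verts R])
      fix x assume "x \<in> ?V - roots f"
      then obtain a where "f x = Some a" "a \<in> out_arcs G x"
        using f by (force simp: roots_def I_def)
      then show "?g x \<in> ?V" by (auto intro: wellformed)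
    qed
    also have "(\<Prod>x\<in>roots f. [:0, 1:]) * (\<Prod>x\<in>?V - roots f. [:m x:]) =
        monom (\<Prod>x\<in>?V - roots f. m x) (card (roots f))"
    proof -
      have "(\<Prod>x\<in>T. [:m x:]) = [:\<Prod>x\<in>T. m x:]" for T
        by (induction T rule: infinite_finite_induct) (auto simp: one_pCons)
      then show ?thesis by (simp add: monom_altdef)
    qed
    finally show ?thesis .
  qed
  have "det_on ?V (\<lambda>x y. of_bool (x = y) * [:0, 1:] -
      [:m x * (\<Sum>a\<in>out_arcs G x. of_bool (head G a = y) - of_bool (x = y)):]) =
    det_on ?V (\<lambda>x y. \<Sum>i\<in>I x. A x i y)"
    by (rule det_on_cong) (rule row)
  also have "\<dots> = (\<Sum>f\<in>PiE ?V I. det_on ?V (\<lambda>x y. A x (f x) y))"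
    by (rule det_on_sum_rows) (auto simp: I_def)
  finally show ?thesis using entry by simp
qed

text \<open>The degree of the monomial of a forest is its number of roots. A nonempty graph has no
  in-forest without roots, and the in-forests with one root are the arborescences.\<close>

lemma laplacian_char_poly_coeffs:
  fixes m :: "'a \<Rightarrow> complex"
  assumes "verts G \<noteq> {}"
  defines "p \<equiv> det_on (verts G) (\<lambda>x y. of_bool (x = y) * [:0, 1:] -
      [:m x * (\<Sum>a\<in>out_arcs G x. of_bool (head G a = y) - of_bool (x = y)):])"
  shows "coeff p 0 = 0"
    and "coeff p 1 = (\<Sum>r\<in>verts G. of_nat (card (arborescences G r)) * (\<Prod>x\<in>verts G - {r}. m x))"
proof -
  let ?V = "verts G"
  define roots where "roots f = {x \<in> verts G. f x = (None :: 'b option)}" for f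
  define I where "I x = insert None (Some ` out_arcs G x)" for x
  define ok where "ok f \<longleftrightarrow> (\<forall>x\<in>?V. leads_to (roots f) (\<lambda>x. head G (the (f x))) x)" for f
  let ?P = "PiE ?V I"
  have fin: "finite ?P" by (intro finite_PiE) (auto simp: I_def)
  have p: "p = (\<Sum>f\<in>?P. if ok f then monom (\<Prod>x\<in>?V - roots f. m x) (card (roots f)) else 0)"
    unfolding p_def ok_def roots_def I_def by (rule laplacian_char_poly_expansion)
  have fin_roots: "finite (roots f)" for f by (auto simp: roots_def)
  have roots_ne: "card (roots f) \<noteq> 0" if "ok f" for f
    using that assms(1) fin_roots[of f] by (auto simp: ok_def leads_to_def)
  have "coeff (if ok f then monom (\<Prod>x\<in>?V - roots f. m x) (card (roots f)) else 0) 0 = 0" for f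
    using roots_ne[of f] by (cases "ok f") simp_all
  then show "coeff p 0 = 0" unfolding p by (simp add: coeff_sum)
  let ?T = "{f \<in> ?P. ok f \<and> card (roots f) = 1}"
  have "coeff p 1 = (\<Sum>f\<in>?P. if ok f \<and> card (roots f) = 1 then \<Prod>x\<in>?V - roots f. m x else 0)"
    unfolding p coeff_sum by (intro sum.cong refl) auto
  also have "\<dots> = (\<Sum>f\<in>?T. \<Prod>x\<in>?V - roots f. m x)"
    using fin by (simp add: sum.If_cases Int_def)
  also have "\<dots> = (\<Sum>(r, h)\<in>Sigma ?V (arborescences G). \<Prod>x\<in>?V - {r}. m x)"
  proof -
    \<comment> \<open>Passes between an option-valued choice with a single \<open>None\<close> and a
      root with an arc choice. The \<open>restrict\<close> makes the result undefined at the root,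
      as \<open>PiE\<close> demands.\<close>
    define to_tree where "to_tree f = (the_elem (roots f),
      restrict (\<lambda>x. the (f x)) (?V - roots f))" for f :: "'a \<Rightarrow> 'b option"
    define of_tree where "of_tree rh = restrict (\<lambda>x. if x = fst rh then None else Some (snd rh x)) ?V"
      for rh :: "'a \<times> ('a \<Rightarrow> 'b)"
    show ?thesis
    proof (rule sum.reindex_bij_witness[where i = of_tree and j = to_tree])
      fix f assume f: "f \<in> ?T"
      then obtain r where r: "roots f = {r}" by (auto simp: card_1_singleton_iff)
      then have rV: "r \<in> ?V" and fr: "f r = None" by (auto simp: roots_def)
      have some: "\<exists>a. f x = Some a \<and> a \<in> out_arcs G x" if "x \<in> ?V" "x \<noteq> r" for x
      proof -
        have "f x \<in> I x" using f that by auto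
        moreover have "x \<notin> roots f" using r that by simp
        ultimately show ?thesis using that by (auto simp: I_def roots_def)
      qed
      have tree: "to_tree f = (r, restrict (\<lambda>x. the (f x)) (?V - {r}))"
        by (simp add: to_tree_def r)
      show "of_tree (to_tree f) = f"
      proof
        fix x show "of_tree (to_tree f) x = f x"
          using f fr some[of x] by (cases "x \<in> ?V") (auto simp: tree of_tree_def PiE_def extensional_def)
      qed
      have "leads_to {r} (\<lambda>x. head G (restrict (\<lambda>x. the (f x)) (?V - {r}) x)) x" if "x \<in> ?V" for x
      proof -
        have "leads_to {r} (\<lambda>x. head G (the (f x))) x"
          using f that by (simp add: ok_def r)
        \<comment> \<open>The two functions may differ at the root, where
          \<open>leads_to_cong\<close> asks for nothing.\<close>
        moreover have "leads_to {r} (\<lambda>x. head G (the (f x))) x \<longleftrightarrow>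
            leads_to {r} (\<lambda>x. head G (restrict (\<lambda>x. the (f x)) (?V - {r}) x)) x"
        proof (rule leads_to_cong[OF that])
          fix z assume "z \<in> ?V - {r}"
          then show "head G (the (f z)) \<in> ?V \<and>
              head G (the (f z)) = head G (restrict (\<lambda>x. the (f x)) (?V - {r}) z)"
            using some[of z] by (auto intro: wellformed)
        qed
        ultimately show ?thesis by simp
      qed
      then show "to_tree f \<in> Sigma ?V (arborescences G)"
        using some rV by (force simp: tree arborescences_def)
      show "(case to_tree f of (r, h) \<Rightarrow> \<Prod>x\<in>?V - {r}. m x) = (\<Prod>x\<in>?V - roots f. m x)"
        by (simp add: tree r)
    next
      fix rh assume rh: "rh \<in> Sigma ?V (arborescences G)"
      obtain r h where [simp]: "rh = (r, h)" by (cases rh)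
      have r: "r \<in> ?V" and h: "h \<in> PiE (?V - {r}) (out_arcs G)"
        and lead: "\<And>x. x \<in> ?V \<Longrightarrow> leads_to {r} (\<lambda>x. head G (h x)) x"
        using rh by (auto simp: arborescences_def)
      have ha: "h x \<in> out_arcs G x" if "x \<in> ?V" "x \<noteq> r" for x
        using PiE_mem[OF h, of x] that by blast
      have roots: "roots (of_tree rh) = {r}" using r by (auto simp: roots_def of_tree_def)
      show "to_tree (of_tree rh) = rh"
      proof -
        have "restrict (\<lambda>x. the (of_tree rh x)) (?V - {r}) = h"
          using h by (auto simp: of_tree_def PiE_def extensional_def fun_eq_iff)
        then show ?thesis unfolding to_tree_def roots by simp
      qed
      have "leads_to {r} (\<lambda>x. head G (the (of_tree rh x))) x" if "x \<in> ?V" for x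
      proof -
        have "leads_to {r} (\<lambda>x. head G (h x)) x \<longleftrightarrow> leads_to {r} (\<lambda>x. head G (the (of_tree rh x))) x"
        proof (rule leads_to_cong[OF that])
          fix z assume "z \<in> ?V - {r}"
          then show "head G (h z) \<in> ?V \<and> head G (h z) = head G (the (of_tree rh z))"
            using ha[of z] by (auto simp: of_tree_def intro: wellformed)
        qed
        then show ?thesis using lead[OF that] by simp
      qed
      then have "ok (of_tree rh)" unfolding ok_def roots by blast
      moreover have "of_tree rh \<in> ?P"
        using ha by (auto simp: of_tree_def I_def)
      moreover have "card (roots (of_tree rh)) = 1" unfolding roots by simp
      ultimately show "of_tree rh \<in> ?T" by blast
    qed
  qed
  also have "\<dots> = (\<Sum>r\<in>?V. \<Sum>h\<in>arborescences G r. \<Prod>x\<in>?V - {r}. m x)"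
    by (rule sum.Sigma[symmetric]) (auto simp: finite_arborescences)
  finally show "coeff p 1 = (\<Sum>r\<in>?V. of_nat (card (arborescences G r)) * (\<Prod>x\<in>?V - {r}. m x))"
    by simp
qed

end

section \<open>In-trees towards a fixed root and undirected spanning trees\<close>

lemma (in pre_digraph) cas_tails_heads:
  assumes "cas u p v"
  shows "insert v (tail G ` set p) = insert u (head G ` set p)"
  using assms by (induction p arbitrary: u) auto

text \<open>Provides an arc before and an arc after any given arc of a cycle without indexing into
  the list.\<close>

lemma (in pre_digraph) closed_cas_tails_heads:
  assumes "cas u p u" "p \<noteq> []"
  shows "tail G ` set p = head G ` set p"
proof -
  have "u \<in> tail G ` set p" using assms by (cases p) auto
  moreover have "u \<in> head G ` set p"
  proof -
    have "v \<in> head G ` set p" if "cas u p v" "p \<noteq> []" for u v and p :: "'b list"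
      using that by (induction p arbitrary: u) (auto, metis cas.simps(1))
    then show ?thesis using assms by blast
  qed
  ultimately show ?thesis using cas_tails_heads[OF assms(1)] by (metis insert_absorb)
qed

text \<open>The tail of the first arc is never visited again, so this arc is not a loop and no later
  arc runs back to its tail; induction handles the rest of the path.\<close>

lemma (in pre_digraph) path_no_backtracking:
  assumes "cas u p v" "distinct (awalk_verts u p)" "a \<in> set p" "b \<in> set p"
    and "tail G b = head G a" "head G b = tail G a"
  shows False
  using assms
proof (induction p arbitrary: u)
  case (Cons e p)
  have verts: "set (awalk_verts w q) = {w} \<union> tail G ` set q \<union> head G ` set q" if "cas w q v" for w q
    using that by (induction q arbitrary: w) auto
  have "cas (head G e) p v" "tail G e \<notin> set (awalk_verts (head G e) p)"
    using Cons.prems by auto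
  then have "tail G e \<noteq> head G e" "tail G e \<notin> tail G ` set p" "tail G e \<notin> head G ` set p"
    using verts by auto
  then show False
    using Cons by (auto simp: image_iff)
qed simp

text \<open>Each vertex picks the first arc of a shortest walk to \<open>r\<close>; the distance
  \<open>rk\<close> then drops at every step.\<close>

lemma arborescence_exists:
  assumes "wf_digraph G" and reach: "\<And>x. x \<in> verts G \<Longrightarrow> x \<rightarrow>\<^sup>*\<^bsub>G\<^esub> r"
  obtains f where "f \<in> arborescences G r"
proof -
  interpret wf_digraph G by fact
  define rk where "rk x = (LEAST n. \<exists>p. awalk x p r \<and> length p = n)" for x
  have step: "\<exists>a. a \<in> out_arcs G x \<and> rk (head G a) < rk x" if x: "x \<in> verts G - {r}" for x
  proof -
    obtain q where "awalk x q r" using reach x by (auto simp: reachable_awalk)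
    then have "\<exists>p. awalk x p r \<and> length p = rk x"
      unfolding rk_def using LeastI_ex[of "\<lambda>n. \<exists>p. awalk x p r \<and> length p = n"] by blast
    then obtain p where p: "awalk x p r" "length p = rk x" by blast
    with x obtain a p' where [simp]: "p = a # p'" by (cases p) (auto simp: awalk_Nil_iff)
    have a: "a \<in> out_arcs G x" "awalk (head G a) p' r" using p by (auto simp: awalk_Cons_iff)
    have "rk (head G a) \<le> length p'"
      unfolding rk_def by (rule Least_le) (rule exI[of _ p'], use a in simp)
    then show ?thesis using a p by auto
  qed
  then obtain h where h: "\<And>x. x \<in> verts G - {r} \<Longrightarrow> h x \<in> out_arcs G x \<and> rk (head G (h x)) < rk x"
    by metis
  let ?f = "restrict h (verts G - {r})"
  have "leads_to {r} (\<lambda>x. head G (?f x)) x" if "x \<in> verts G" for x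
  proof (rule leads_toI_rank[OF that, where rk = rk])
    fix x assume x: "x \<in> verts G - {r}"
    then show "head G (?f x) \<in> verts G \<and> rk (head G (?f x)) < rk x"
      using h[OF x] by (auto intro: wellformed)
  qed
  then have "?f \<in> arborescences G r"
    using h by (auto simp: arborescences_def)
  then show thesis by (rule that)
qed

context bidirected_digraph
begin

definition tree_arcs :: "'a \<Rightarrow> ('a \<Rightarrow> 'b) \<Rightarrow> 'b set" where
  "tree_arcs r f = f ` (verts G - {r}) \<union> arev ` f ` (verts G - {r})"

definition tree_of :: "'a \<Rightarrow> ('a \<Rightarrow> 'b) \<Rightarrow> ('a, 'b) pre_digraph" where
  "tree_of r f = G\<lparr>arcs := tree_arcs r f\<rparr>"

lemma symmetric_subgraph:
  assumes "T \<subseteq> arcs G" "arev ` T \<subseteq> T"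
  shows "wf_digraph (G\<lparr>arcs := T\<rparr>)"
    and "symmetric (G\<lparr>arcs := T\<rparr>)"
    and "Digraph_Component.connected (G\<lparr>arcs := T\<rparr>) \<longleftrightarrow> verts G \<noteq> {} \<and>
      (\<forall>x\<in>verts G. \<forall>y\<in>verts G. x \<rightarrow>\<^sup>*\<^bsub>G\<lparr>arcs := T\<rparr>\<^esub> y)"
proof -
  let ?H = "G\<lparr>arcs := T\<rparr>"
  show wf: "wf_digraph ?H"
    by unfold_locales (use assms in \<open>auto intro: wellformed\<close>)
  show sym: "symmetric ?H"
    unfolding symmetric_def
  proof (rule symI)
    fix x y assume "(x, y) \<in> arcs_ends ?H"
    then obtain a where a: "a \<in> T" "tail G a = x" "head G a = y"
      by (auto simp: arcs_ends_def arc_to_ends_def)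
    then have "arev a \<in> T" "tail G (arev a) = y" "head G (arev a) = x" using assms by auto
    then show "(y, x) \<in> arcs_ends ?H" by (force simp: arcs_ends_def arc_to_ends_def)
  qed
  show "Digraph_Component.connected ?H \<longleftrightarrow> verts G \<noteq> {} \<and>
      (\<forall>x\<in>verts G. \<forall>y\<in>verts G. x \<rightarrow>\<^sup>*\<^bsub>?H\<^esub> y)"
    by (simp add: connected_def strongly_connected_def wf_digraph.reachable_mk_symmetric_eq[OF wf sym])
qed

lemma arborescence_arc:
  assumes "f \<in> arborescences G r" "x \<in> verts G - {r}"
  shows "f x \<in> arcs G" "tail G (f x) = x" "head G (f x) \<in> verts G"
    "steps_to {r} (\<lambda>x. head G (f x)) x = Suc (steps_to {r} (\<lambda>x. head G (f x)) (head G (f x)))"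
proof -
  have "f x \<in> out_arcs G x"
    using assms PiE_mem[of f "verts G - {r}" "out_arcs G" x] by (auto simp: arborescences_def)
  then show "f x \<in> arcs G" "tail G (f x) = x" "head G (f x) \<in> verts G" by (auto intro: wellformed)
  show "steps_to {r} (\<lambda>x. head G (f x)) x = Suc (steps_to {r} (\<lambda>x. head G (f x)) (head G (f x)))"
    by (rule steps_to_step) (use assms in \<open>auto simp: arborescences_def\<close>)
qed

lemma tree_arcs_props:
  assumes f: "f \<in> arborescences G r"
  shows "tree_arcs r f \<subseteq> arcs G" "arev ` tree_arcs r f \<subseteq> tree_arcs r f"
    and "a \<in> tree_arcs r f \<Longrightarrow> (tail G a \<in> verts G - {r} \<and> a = f (tail G a)) \<or>
      (head G a \<in> verts G - {r} \<and> arev a = f (head G a))"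
proof -
  note arc = arborescence_arc(1,2)[OF f]
  show "tree_arcs r f \<subseteq> arcs G" using arc(1) by (auto simp: tree_arcs_def intro!: arev_in_arcs)
  show "arev ` tree_arcs r f \<subseteq> tree_arcs r f" by (auto simp: tree_arcs_def)
  assume "a \<in> tree_arcs r f"
  then obtain x where x: "x \<in> verts G - {r}" and "a = f x \<or> a = arev (f x)"
    by (auto simp: tree_arcs_def)
  then show "(tail G a \<in> verts G - {r} \<and> a = f (tail G a)) \<or>
      (head G a \<in> verts G - {r} \<and> arev a = f (head G a))"
    using arc(1)[OF x] arc(2)[OF x] by auto
qed

lemma tree_of_spanning_tree:
  assumes r: "r \<in> verts G" and f: "f \<in> arborescences G r"
  shows "undirected_spanning_tree (tree_of r f) G arev"
proof -
  let ?H = "tree_of r f" and ?rk = "steps_to {r} (\<lambda>x. head G (f x))"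
  note T = tree_arcs_props[OF f] and arc = arborescence_arc[OF f]
  have wf: "wf_digraph ?H" and sym: "symmetric ?H"
    using symmetric_subgraph(1,2)[OF T(1,2)] unfolding tree_of_def .
  interpret H: wf_digraph ?H by fact
  have verts: "verts ?H = verts G" and arcs: "arcs ?H = tree_arcs r f"
    and [simp]: "tail ?H = tail G" "head ?H = head G"
    by (simp_all add: tree_of_def)
  have "x \<rightarrow>\<^sup>*\<^bsub>?H\<^esub> r" if "x \<in> verts G" for x
    using that
  proof (induction "?rk x" arbitrary: x rule: less_induct)
    case less
    show ?case
    proof (cases "x = r")
      case False
      with less have x: "x \<in> verts G - {r}" by blast
      then have "head G (f x) \<rightarrow>\<^sup>*\<^bsub>?H\<^esub> r" using less(1) arc(3,4)[OF x] by simp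
      moreover have "(x, head G (f x)) \<in> arcs_ends ?H"
        using x arc(2)[OF x] by (force simp: arcs_ends_def arc_to_ends_def arcs tree_arcs_def)
      ultimately show ?thesis by (metis H.adj_reachable_trans)
    qed (use r verts in simp)
  qed
  then have "x \<rightarrow>\<^sup>*\<^bsub>?H\<^esub> y" if "x \<in> verts G" "y \<in> verts G" for x y
    using that symmetric_reachable[OF sym] by (meson H.reachable_trans)
  then have "Digraph_Component.connected ?H"
    using symmetric_subgraph(3)[OF T(1,2)] r unfolding tree_of_def by blast
  moreover have False if p: "pre_digraph.cycle ?H p" "\<forall>e\<in>set p. arev e \<notin> set p" for p
  proof -
    obtain u where "H.awalk u p u" and ne: "p \<noteq> []" using p(1) by (auto simp: H.cycle_def)
    then have p_arcs: "set p \<subseteq> tree_arcs r f" and "H.cas u p u" by (auto simp: H.awalk_def arcs)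
    then have ends: "tail G ` set p = head G ` set p"
      using H.closed_cas_tails_heads[OF _ ne] by auto
    \<comment> \<open>at a vertex of the cycle farthest from \<open>r\<close> the cycle turns back along the same edge\<close>
    let ?M = "Max ((\<lambda>e. ?rk (head G e)) ` set p)"
    have "?M \<in> (\<lambda>e. ?rk (head G e)) ` set p" using ne by (intro Max_in) auto
    then obtain e where e: "e \<in> set p" "?rk (head G e) = ?M" by auto
    have max: "?rk (head G e') \<le> ?rk (head G e)" if "e' \<in> set p" for e'
      unfolding e(2) using that by (intro Max_ge) auto
    obtain e' where e': "e' \<in> set p" "tail G e' = head G e"
      using e(1) ends by (metis image_iff)
    \<comment> \<open>If \<open>e\<close> were the arc chosen at its tail, that tail would be
      farther from \<open>r\<close> than the maximum, although some arc of the cycle enters it.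
      Hence \<open>arev e\<close> is the arc chosen at \<open>head G e\<close>.\<close>
    have "\<not> (tail G e \<in> verts G - {r} \<and> e = f (tail G e))"
    proof
      assume "tail G e \<in> verts G - {r} \<and> e = f (tail G e)"
      then have "?rk (tail G e) = Suc (?rk (head G e))" using arc(4)[of "tail G e"] by simp
      moreover obtain e'' where "e'' \<in> set p" "head G e'' = tail G e"
        using e(1) ends by (metis image_iff)
      ultimately show False using max[of e''] by simp
    qed
    then have rev: "head G e \<in> verts G - {r}" "arev e = f (head G e)"
      using T(3)[of e] p_arcs e(1) by blast+
    \<comment> \<open>By the same comparison the following arc \<open>e'\<close> is the arc chosen
      at its tail, which makes it equal to \<open>arev e\<close>.\<close>
    have "\<not> (head G e' \<in> verts G - {r} \<and> arev e' = f (head G e'))"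
    proof
      assume h: "head G e' \<in> verts G - {r} \<and> arev e' = f (head G e')"
      have "e' \<in> arcs G" using e'(1) p_arcs T(1) by blast
      then have "head G (f (head G e')) = tail G e'" using h by (metis head_arev)
      then have "?rk (head G e') = Suc (?rk (tail G e'))" using arc(4)[of "head G e'"] h by simp
      then show False using max[of e'] e' by simp
    qed
    then have "e' = f (head G e)" using T(3)[of e'] p_arcs e' by auto
    then show False using rev p(2) e e' by auto
  qed
  ultimately have "undirected_tree ?H arev" unfolding undirected_tree_def by blast
  moreover have "spanning ?H G"
    using wf T(1) by (auto simp: spanning_def subgraph_def compatible_def verts arcs wf_digraph_axioms)
  ultimately show ?thesis
    using T(2) unfolding undirected_spanning_tree_def arcs by blast
qed

text \<open>The tree determines the arc towards the root, by induction on the depth under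
  \<open>f'\<close>. If \<open>f x\<close> and \<open>f' x\<close> differed, \<open>f' x\<close>
  would be the reverse of the arc that both functions choose at its head, so \<open>x\<close> would
  be one step farther and one step nearer than that head at once.\<close>

lemma inj_on_tree_of: "inj_on (tree_of r) (arborescences G r)"
proof (rule inj_onI)
  fix f f' assume f: "f \<in> arborescences G r" and f': "f' \<in> arborescences G r"
    and eq: "tree_of r f = tree_of r f'"
  have T: "tree_arcs r f = tree_arcs r f'"
    using arg_cong[OF eq, of arcs] by (simp add: tree_of_def)
  let ?rk = "steps_to {r} (\<lambda>x. head G (f' x))"
  have same: "f x = f' x" if "x \<in> verts G - {r}" for x
    using that
  proof (induction "?rk x" arbitrary: x rule: less_induct)
    case less
    let ?y = "head G (f' x)"
    note x = arborescence_arc[OF f' less.prems]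
    show ?case
    proof (rule ccontr)
      assume ne: "f x \<noteq> f' x"
      have "f' x \<in> tree_arcs r f" unfolding T using less.prems by (auto simp: tree_arcs_def)
      then have y: "?y \<in> verts G - {r}" "arev (f' x) = f ?y"
        using tree_arcs_props(3)[OF f, of "f' x"] ne x(2) by auto
      then have "f ?y = f' ?y" using less.hyps[of ?y] x(4) by simp
      then have "head G (f' ?y) = x" using y(2) x(1,2) by (metis head_arev)
      then show False using arborescence_arc(4)[OF f' y(1)] x(4) by simp
    qed
  qed
  show "f = f'"
    by (rule PiE_ext[of f "verts G - {r}" "out_arcs G"]) (use f f' same in \<open>auto simp: arborescences_def\<close>)
qed

text \<open>Any in-tree inside the connected graph \<open>H\<close> already exhausts
  \<open>H\<close>: a further arc would close a tree path to a cycle.\<close>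

lemma spanning_tree_is_tree_of:
  assumes r: "r \<in> verts G" and H: "undirected_spanning_tree H G arev"
  obtains f where "f \<in> arborescences G r" "H = tree_of r f"
proof -
  have verts: "verts H = verts G" and tl: "tail H = tail G" and hd: "head H = head G"
    and sub: "arcs H \<subseteq> arcs G" and rev: "arev ` arcs H \<subseteq> arcs H"
    and conn: "Digraph_Component.connected H"
    and acyc: "\<And>p. pre_digraph.cycle H p \<Longrightarrow> \<exists>e\<in>set p. arev e \<in> set p"
    using H by (auto simp: undirected_spanning_tree_def undirected_tree_def spanning_def
        subgraph_def compatible_def)
  have H_eq: "H = G\<lparr>arcs := arcs H\<rparr>" using verts tl hd by (cases H, cases G) simp
  have wf: "wf_digraph H" using symmetric_subgraph(1)[OF sub rev] H_eq by simp
  interpret H: wf_digraph H by fact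
  have reach: "\<forall>x\<in>verts G. \<forall>y\<in>verts G. x \<rightarrow>\<^sup>*\<^bsub>H\<^esub> y"
    using symmetric_subgraph(3)[OF sub rev] conn H_eq by simp
  obtain f where fH: "f \<in> arborescences H r"
    using arborescence_exists[OF wf, of r] reach r verts by metis
  have fH_arc: "f x \<in> arcs H" if "x \<in> verts G - {r}" for x
    using fH that PiE_mem[of f "verts G - {r}" "out_arcs H" x] by (auto simp: arborescences_def verts)
  have f: "f \<in> arborescences G r"
    using fH sub by (auto simp: arborescences_def verts hd tl PiE_iff)
  have T_sub: "tree_arcs r f \<subseteq> arcs H" using fH_arc rev by (auto simp: tree_arcs_def)
  have "e \<in> tree_arcs r f" if e: "e \<in> arcs H" for e
  proof (rule ccontr)
    assume notin: "e \<notin> tree_arcs r f"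
    let ?K = "tree_of r f"
    note T = tree_arcs_props[OF f]
    interpret K: wf_digraph ?K
      using symmetric_subgraph(1)[OF T(1,2)] unfolding tree_of_def .
    have notin_rev: "arev e \<notin> tree_arcs r f"
      using T(2) notin by (metis arev_arev image_subset_iff)
    have "Digraph_Component.connected ?K"
      using tree_of_spanning_tree[OF r f]
      by (simp add: undirected_spanning_tree_def undirected_tree_def)
    then have "head G e \<rightarrow>\<^sup>*\<^bsub>?K\<^esub> tail G e"
      using symmetric_subgraph(3)[OF T(1,2)] e sub unfolding tree_of_def
      by (meson subsetD wellformed)
    \<comment> \<open>A simple tree path from the head of \<open>e\<close> back to its tail;
      preceded by \<open>e\<close> it becomes a cycle of \<open>H\<close>.\<close>
    then obtain p where p: "K.apath (head G e) p (tail G e)"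
      by (auto simp: K.reachable_apath)
    have K: "tail ?K = tail G" "head ?K = head G" "arcs ?K = tree_arcs r f" by (auto simp: tree_of_def)
    have compat: "compatible ?K H" by (simp add: compatible_def K tl hd)
    have p_arcs: "set p \<subseteq> tree_arcs r f" and cas: "K.cas (head G e) p (tail G e)"
      and dist: "distinct (K.awalk_verts (head G e) p)"
      using p by (auto simp: K.apath_def K.awalk_def K)
    have "H.cycle (e # p)"
      unfolding H.cycle_def
    proof (intro exI conjI)
      show "H.awalk (tail G e) (e # p) (tail G e)"
        using e T_sub p_arcs cas compatible_cas[OF compat] H.wellformed[OF e]
        by (auto simp: H.awalk_def tl hd)
      show "distinct (tl (H.awalk_verts (tail G e) (e # p)))"
        using dist compatible_awalk_verts[OF compat] by (simp add: hd)
    qed simp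
    \<comment> \<open>Acyclicity of \<open>H\<close> yields an arc that the cycle uses in both
      directions. It cannot involve \<open>e\<close>, whose reverse lies outside the tree, and a
      simple path does not backtrack.\<close>
    then obtain a where a: "a \<in> set (e # p)" "arev a \<in> set (e # p)" using acyc by blast
    have "e \<in> arcs G" using e sub by blast
    have "a \<noteq> e" using a notin_rev p_arcs arev_neq[OF \<open>e \<in> arcs G\<close>] by auto
    moreover have "arev a \<noteq> e" using a notin_rev p_arcs calculation arev_arev by (metis set_ConsD subsetD)
    ultimately have "a \<in> set p" "arev a \<in> set p" using a by auto
    moreover have "a \<in> arcs G" using calculation p_arcs T(1) by blast
    ultimately show False
      using K.path_no_backtracking[OF cas dist, of a "arev a"] by (simp add: K)
  qed
  with T_sub have "arcs H = tree_arcs r f" by blast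
  then have "H = tree_of r f" using H_eq by (simp add: tree_of_def)
  with f show thesis by (rule that)
qed

text \<open>Every undirected spanning tree has exactly one orientation towards \<open>r\<close>, so
  the count is the same for all roots.\<close>

lemma card_arborescences:
  assumes "r \<in> verts G"
  shows "card (arborescences G r) = num_spanning_trees G arev"
proof -
  have "bij_betw (tree_of r) (arborescences G r) {H. undirected_spanning_tree H G arev}"
    unfolding bij_betw_def
    using inj_on_tree_of tree_of_spanning_tree[OF assms] spanning_tree_is_tree_of[OF assms]
    by blast
  then show ?thesis unfolding num_spanning_trees_def by (rule bij_betw_same_card)
qed

end

lemma (in finite_connected_graph) num_spanning_trees_pos: "num_spanning_trees G arev > 0"
proof -
  have "symmetric G" by (rule sym_arcs)
  then have "verts G \<noteq> {}" and reach: "\<And>x y. x \<in> verts G \<Longrightarrow> y \<in> verts G \<Longrightarrow> x \<rightarrow>\<^sup>*\<^bsub>G\<^esub> y"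
    using connected by (auto simp: connected_def strongly_connected_def reachable_mk_symmetric_eq)
  then obtain r where r: "r \<in> verts G" by blast
  obtain f where "f \<in> arborescences G r"
    using arborescence_exists[OF wf_digraph_axioms, of r] reach r by blast
  then show ?thesis using card_arborescences[OF r] finite_arborescences[of r]
    by (metis card_gt_0_iff empty_iff)
qed

section \<open>Cyclic subgroups\<close>

text \<open>Only squarefree divisors count. For a prime \<open>p\<close> dividing \<open>n\<close>
  they pair off as \<open>d\<close> and \<open>p * d\<close> with opposite signs.\<close>

lemma sum_moebius_mu:
  fixes n :: nat
  assumes "n > 0"
  shows "(\<Sum>d | d dvd n. moebius_mu d) = of_bool (n = 1)"
proof (cases "n = 1")
  case True
  then have "{d. d dvd n} = {1}" by auto
  then show ?thesis using True by (simp add: moebius_mu_def)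
next
  case False
  then obtain p where p: "prime p" "p dvd n" using prime_factor_nat by blast
  define A where "A = {d. d dvd n \<and> squarefree d \<and> \<not> p dvd d}"
  have fin: "finite {d. d dvd n}" using assms by simp
  have finA: "finite A" by (rule finite_subset[OF _ fin]) (auto simp: A_def)
  have inj: "inj_on ((*) p) A" using p by (auto simp: inj_on_def prime_gt_0_nat)
  have sqfree: "{d. d dvd n \<and> squarefree d} = A \<union> (*) p ` A"
  proof (intro equalityI subsetI)
    fix d assume d: "d \<in> {d. d dvd n \<and> squarefree d}"
    show "d \<in> A \<union> (*) p ` A"
    proof (cases "p dvd d")
      case True
      then obtain c where c: "d = p * c" by blast
      have "\<not> p dvd c"
      proof
        assume "p dvd c"
        then have "p ^ 2 dvd d" by (simp add: c power2_eq_square)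
        then have "p dvd 1" using d squarefreeD[of d p] by blast
        then show False using p(1) not_prime_unit by blast
      qed
      moreover have "c dvd n" "squarefree c"
        using d squarefree_mono[of c d] by (auto simp: c intro: dvd_mult_right)
      ultimately show ?thesis by (auto simp: A_def c)
    qed (use d in \<open>auto simp: A_def\<close>)
  next
    fix d assume "d \<in> A \<union> (*) p ` A"
    then show "d \<in> {d. d dvd n \<and> squarefree d}"
    proof
      assume "d \<in> (*) p ` A"
      then obtain c where c: "c \<in> A" "d = p * c" by blast
      then have "coprime p c" using p(1) by (auto simp: A_def prime_imp_coprime)
      then show ?thesis using c p
        by (auto simp: A_def squarefree_mult_coprime squarefree_prime divides_mult)
    qed (auto simp: A_def)
  qed
  have "(\<Sum>d | d dvd n. moebius_mu d) = (\<Sum>d | d dvd n \<and> squarefree d. moebius_mu d)"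
    by (rule sum.mono_neutral_right[OF fin]) (auto simp: moebius_mu_def)
  also have "\<dots> = (\<Sum>d\<in>A. moebius_mu d) + (\<Sum>d\<in>(*) p ` A. moebius_mu d)"
    unfolding sqfree using finA by (intro sum.union_disjoint) (auto simp: A_def)
  also have "(\<Sum>d\<in>(*) p ` A. moebius_mu d) = (\<Sum>d\<in>A. - moebius_mu d)"
    unfolding sum.reindex[OF inj]
  proof (rule sum.cong[OF refl])
    fix d assume d: "d \<in> A"
    then have "d > 0" using assms by (auto simp: A_def intro: Nat.gr0I)
    then have "prime_factors (p * d) = insert p (prime_factors d)"
      using p(1) by (simp add: prime_factors_product prime_prime_factors prime_gt_0_nat)
    moreover have "p \<notin> prime_factors d" using d by (auto simp: A_def)
    moreover have "squarefree (p * d)" using sqfree d by blast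
    ultimately show "(moebius_mu \<circ> (*) p) d = - moebius_mu d"
      using d by (simp add: moebius_mu_def A_def)
  qed
  finally show ?thesis using False by (simp add: sum_negf)
qed

context group
begin

lemma subgroup_index_mult_card:
  assumes "finite (carrier G)" "subgroup H G"
  shows "subgroup_index G H * card H = card (carrier G)"
  using lagrange[OF assms(2)] by (simp add: subgroup_index_def Coset.order_def)

lemma cyclic_subgroups_eq: "cyclic_subgroups G = (\<lambda>x. generate G {x}) ` carrier G"
proof -
  have "cyclic_group (G\<lparr>carrier := H\<rparr>) \<longleftrightarrow> (\<exists>x\<in>H. H = generate G {x})" if H: "subgroup H G" for H
  proof -
    interpret H: group "G\<lparr>carrier := H\<rparr>" using H by (rule subgroup_imp_group)
    have "range (\<lambda>n::int. x [^]\<^bsub>G\<lparr>carrier := H\<rparr>\<^esub> n) = generate G {x}" if "x \<in> H" for x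
    proof -
      have "x \<in> carrier G" using that H subgroup.subset by blast
      then show ?thesis
        using generate_pow[of x] int_pow_consistent[OF H that] by auto
    qed
    then show ?thesis unfolding H.cyclic_group by auto
  qed
  moreover have "x \<in> generate G {x}" for x by (simp add: generate.incl)
  moreover have "subgroup (generate G {x}) G" if "x \<in> carrier G" for x
    using that by (simp add: generate_is_subgroup)
  ultimately show ?thesis
    unfolding cyclic_subgroups_def by (auto dest: subgroup.mem_carrier)
qed

text \<open>With \<open>ord z = d * e\<close>, the \<open>d\<close>-th power of
  \<open>z [^] k\<close> is trivial exactly when \<open>e\<close> divides \<open>k\<close>. The
  torsion sets thus supply a cyclic subgroup of each order dividing \<open>ord z\<close>.\<close>

lemma cyclic_subgroup_torsion:
  assumes fin: "finite (carrier G)" and z: "z \<in> carrier G" and d: "d dvd ord z"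
  shows "{x \<in> generate G {z}. x [^] d = \<one>} = generate G {z [^] (ord z div d)}"
    and "card (generate G {z [^] (ord z div d)}) = d"
proof -
  have pos: "ord z > 0" using ord_ge_1[OF fin z] by simp
  then have dpos: "d > 0" using d by (auto intro: Nat.gr0I)
  obtain e where e: "ord z = d * e" using d by blast
  then have epos: "e > 0" using pos by (auto intro: Nat.gr0I)
  have div: "ord z div d = e" using e dpos by simp
  have gen: "generate G {x} = range (\<lambda>k::nat. x [^] k)" if "x \<in> carrier G" for x
    using generate_pow_nat[OF that] ord_ge_1[OF fin that] by auto
  have "z [^] (k * d) = \<one> \<longleftrightarrow> e dvd k" for k :: nat
    using z dpos by (simp add: pow_eq_id e mult.commute)
  then show "{x \<in> generate G {z}. x [^] d = \<one>} = generate G {z [^] (ord z div d)}"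
    using z unfolding div by (auto simp: gen nat_pow_pow dvd_def)
  show "card (generate G {z [^] (ord z div d)}) = d"
    using z e epos dpos
    by (simp add: div generate_pow_card[symmetric] ord_pow)
qed

text \<open>By Lagrange \<open>H\<close> lies in the torsion of exponent \<open>card H\<close>,
  which has the same number of elements; so a subgroup of a finite cyclic group is determined by its
  order.\<close>

lemma subgroup_of_cyclic_eq_torsion:
  assumes fin: "finite (carrier G)" and z: "z \<in> carrier G" and H: "subgroup H G" "H \<subseteq> generate G {z}"
  shows "card H dvd ord z" and "H = {x \<in> generate G {z}. x [^] card H = \<one>}"
proof -
  let ?B = "generate G {z}"
  have B: "subgroup ?B G" using z by (simp add: generate_is_subgroup)
  interpret B: group "G\<lparr>carrier := ?B\<rparr>" using B by (rule subgroup_imp_group)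
  interpret H: group "G\<lparr>carrier := H\<rparr>" using H(1) by (rule subgroup_imp_group)
  have finH: "finite H" using H(1) fin by (meson finite_subset subgroup.subset)
  have finB: "finite ?B" using B fin by (meson finite_subset subgroup.subset)
  have "subgroup H (G\<lparr>carrier := ?B\<rparr>)"
    using subgroup_incl[OF H(1) B H(2)] .
  from B.lagrange[OF this] show dvd: "card H dvd ord z"
    unfolding generate_pow_card[OF z]
    by (intro dvdI[of _ _ "card (rcosets\<^bsub>G\<lparr>carrier := ?B\<rparr>\<^esub> H)"])
      (simp add: Coset.order_def mult.commute)
  have "x [^] card H = \<one>" if "x \<in> H" for x
    using H.pow_order_eq_1[of x] that nat_pow_consistent[of x _ H] by (simp add: Coset.order_def)
  then have sub: "H \<subseteq> {x \<in> ?B. x [^] card H = \<one>}" using H(2) by blast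
  moreover have "card {x \<in> ?B. x [^] card H = \<one>} = card H"
    using cyclic_subgroup_torsion[OF fin z dvd] by simp
  ultimately show "H = {x \<in> ?B. x [^] card H = \<one>}"
    using finB by (intro card_subset_eq) auto
qed

text \<open>Through their index in \<open>B\<close>, the subgroups between
  \<open>generate G {b}\<close> and \<open>B\<close> correspond to the divisors of the index of
  \<open>generate G {b}\<close> in \<open>B\<close>, so the claim reduces to
  \<open>sum_moebius_mu\<close>.\<close>

lemma sum_moebius_between:
  assumes fin: "finite (carrier G)" and B: "B \<in> cyclic_subgroups G" and b: "b \<in> carrier G"
  shows "(\<Sum>C | C \<in> cyclic_subgroups G \<and> b \<in> C \<and> C \<subseteq> B. moebius_mu (subgroup_index (G\<lparr>carrier := B\<rparr>) C)) =
    of_bool (B = generate G {b})"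
proof (cases "b \<in> B")
  case False
  then have "{C. C \<in> cyclic_subgroups G \<and> b \<in> C \<and> C \<subseteq> B} = {}" by blast
  moreover have "B \<noteq> generate G {b}" using False generate.incl[of b "{b}" G] by auto
  ultimately show ?thesis by (simp only: sum.empty of_bool_def if_False simp_thms)
next
  case True
  obtain z where z: "z \<in> carrier G" and Bz: "B = generate G {z}"
    using B by (auto simp: cyclic_subgroups_eq)
  have subB: "subgroup B G" using z Bz by (simp add: generate_is_subgroup)
  interpret B: group "G\<lparr>carrier := B\<rparr>" using subB by (rule subgroup_imp_group)
  have finB: "finite B" using subB fin by (meson finite_subset subgroup.subset)
  define n where "n = ord z"
  have n: "n > 0" "card B = n"
    using ord_ge_1[OF fin z] generate_pow_card[OF z] by (auto simp: n_def Bz)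
  have gen_b: "generate G {b} \<subseteq> B"
    using True subB by (simp add: generate_subgroup_incl)
  have card_b: "card (generate G {b}) = ord b" using generate_pow_card[OF b] by simp
  have ord_b: "ord b dvd n" "ord b > 0"
    using subgroup_of_cyclic_eq_torsion(1)[OF fin z, of "generate G {b}"] gen_b card_b
      generate_is_subgroup[of "{b}"] b ord_ge_1[OF fin b] by (auto simp: n_def Bz)
  \<comment> \<open>\<open>N\<close> is the index of \<open>generate G {b}\<close> in
    \<open>B\<close>.\<close>
  then obtain N where N: "n = ord b * N" by blast
  have Npos: "N > 0" using N n by (auto intro: Nat.gr0I)
  let ?S = "{C. C \<in> cyclic_subgroups G \<and> b \<in> C \<and> C \<subseteq> B}"
  define tor where "tor d = {x \<in> B. x [^] d = \<one>}" for d :: nat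
  have cyc: "C = tor (card C) \<and> card C dvd n" if "C \<in> cyclic_subgroups G" "C \<subseteq> B" for C
    using subgroup_of_cyclic_eq_torsion[OF fin z, of C] that
    unfolding tor_def Bz n_def cyclic_subgroups_def by blast
  have tor: "card (tor d) = d" "tor d \<in> cyclic_subgroups G" if "d dvd n" for d
    using cyclic_subgroup_torsion[OF fin z, of d] that z
    unfolding tor_def Bz n_def cyclic_subgroups_eq by auto
  have "(\<Sum>C\<in>?S. moebius_mu (subgroup_index (G\<lparr>carrier := B\<rparr>) C)) = (\<Sum>e | e dvd N. moebius_mu e)"
  \<comment> \<open>The subgroup of index \<open>e\<close> is recovered as the torsion of exponent
    \<open>n div e\<close>.\<close>
  proof (rule sum.reindex_bij_witness[where i = "\<lambda>e. tor (n div e)" and j = "\<lambda>C. n div card C"])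
    fix C assume C: "C \<in> ?S"
    then have sub: "subgroup C G" and eq: "C = tor (card C)" and dvd: "card C dvd n"
      using cyc by (auto simp: cyclic_subgroups_def)
    then obtain e where e: "n = card C * e" by blast
    with n have pos: "card C > 0" "e > 0" by (auto intro: Nat.gr0I)
    have ndiv: "n div card C = e" using e pos by simp
    then show "tor (n div (n div card C)) = C" using eq e pos by simp
    have "b [^] card C = \<one>" using C eq by (auto simp: tor_def)
    then have "ord b dvd card C" using b by (simp add: pow_eq_id)
    then obtain k where "card C = ord b * k" by blast
    then have "N = k * e" using e N ord_b by (simp add: mult.assoc)
    then show "n div card C \<in> {e. e dvd N}" by (simp add: ndiv)
    have "subgroup C (G\<lparr>carrier := B\<rparr>)" using subgroup_incl[OF sub subB] C by blast
    then have "subgroup_index (G\<lparr>carrier := B\<rparr>) C * card C = n"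
      using B.subgroup_index_mult_card[of C] finB n by simp
    then have "subgroup_index (G\<lparr>carrier := B\<rparr>) C = n div card C"
      using pos by (metis nonzero_mult_div_cancel_right less_irrefl)
    then show "moebius_mu (n div card C) = moebius_mu (subgroup_index (G\<lparr>carrier := B\<rparr>) C)" by simp
  next
    fix e assume "e \<in> {e. e dvd N}"
    then obtain k where k: "N = e * k" by blast
    with Npos have pos: "e > 0" "k > 0" by (auto intro: Nat.gr0I)
    have ndiv: "n div e = ord b * k" using pos by (simp add: N k)
    have dvd: "n div e dvd n" unfolding ndiv by (simp add: N k)
    show "n div card (tor (n div e)) = e"
      unfolding tor(1)[OF dvd] unfolding ndiv using pos ord_b by (simp add: N k)
    have "b [^] (n div e) = \<one>" using b by (simp add: ndiv pow_eq_id)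
    then show "tor (n div e) \<in> ?S" using tor(2)[OF dvd] True by (auto simp: tor_def)
  qed
  also have "\<dots> = of_bool (N = 1)" by (rule sum_moebius_mu[OF Npos])
  also have "N = 1 \<longleftrightarrow> B = generate G {b}"
  proof
    assume "N = 1"
    then have "card (generate G {b}) = card B" using N n card_b by simp
    then show "B = generate G {b}" using gen_b finB by (metis card_subset_eq)
  next
    assume "B = generate G {b}"
    then show "N = 1" using N n card_b ord_b by simp
  qed
  finally show ?thesis .
qed

text \<open>Index and order of \<open>C\<close> combine to the order of the group. After exchanging
  the two sums, \<open>sum_moebius_between\<close> leaves only the term
  \<open>B = generate G {b}\<close>.\<close>

lemma sum_cyclic_exponent_containing:
  assumes fin: "finite (carrier G)" and b: "b \<in> carrier G"
  shows "(\<Sum>C | C \<in> cyclic_subgroups G \<and> b \<in> C. cyclic_exponent G C / real (card C)) =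
    1 / real (card (carrier G))"
proof -
  let ?I = "cyclic_subgroups G" and ?n = "real (card (carrier G))"
  let ?mu = "\<lambda>B C. real_of_int (moebius_mu (subgroup_index (G\<lparr>carrier := B\<rparr>) C))"
  have finI: "finite ?I" using fin by (simp add: cyclic_subgroups_eq)
  have expo: "cyclic_exponent G C / real (card C) = (\<Sum>B\<in>{B \<in> ?I. C \<subseteq> B}. ?mu B C) / ?n" if "C \<in> ?I" for C
  proof -
    have "real (subgroup_index G C) * real (card C) = ?n"
      using subgroup_index_mult_card[OF fin, of C] that
      by (simp add: cyclic_subgroups_def flip: of_nat_mult)
    then show ?thesis by (simp add: cyclic_exponent_def flip: \<open>_ = ?n\<close>)
  qed
  have "(\<Sum>C | C \<in> ?I \<and> b \<in> C. cyclic_exponent G C / real (card C)) =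
      (\<Sum>C | C \<in> ?I \<and> b \<in> C. \<Sum>B\<in>{B \<in> ?I. C \<subseteq> B}. ?mu B C) / ?n"
    using expo by (simp add: sum_divide_distrib)
  also have "(\<Sum>C | C \<in> ?I \<and> b \<in> C. \<Sum>B\<in>{B \<in> ?I. C \<subseteq> B}. ?mu B C) =
      (\<Sum>B\<in>?I. \<Sum>C | C \<in> {C \<in> ?I. b \<in> C} \<and> C \<subseteq> B. ?mu B C)"
    using sum.swap_restrict[of "{C \<in> ?I. b \<in> C}" ?I "\<lambda>C B. ?mu B C" "\<lambda>C B. C \<subseteq> B"] finI by simp
  also have "\<dots> = (\<Sum>B\<in>?I. real_of_int (of_bool (B = generate G {b})))"
    using sum_moebius_between[OF fin _ b] by (simp flip: of_int_sum add: conj_assoc)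
  also have "\<dots> = 1"
    using finI b by (subst sum.remove[of _ "generate G {b}"]) (auto simp: cyclic_subgroups_eq intro!: sum.neutral)
  finally show ?thesis .
qed

text \<open>This is Artin induction for the trivial character.\<close>

lemma average_eq_sum_cyclic_averages:
  fixes \<chi> :: "'a \<Rightarrow> 'c :: real_normed_field"
  assumes fin: "finite (carrier G)"
  shows "(\<Sum>g\<in>carrier G. \<chi> g) / of_nat (card (carrier G)) =
    (\<Sum>C\<in>cyclic_subgroups G. of_real (cyclic_exponent G C) * ((\<Sum>g\<in>C. \<chi> g) / of_nat (card C)))"
proof -
  let ?I = "cyclic_subgroups G"
  let ?w = "\<lambda>C. cyclic_exponent G C / real (card C)"
  have finI: "finite ?I" using fin by (simp add: cyclic_subgroups_eq)
  have sub: "C = {g \<in> carrier G. g \<in> C}" if "C \<in> ?I" for C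
    using that by (auto simp: cyclic_subgroups_def dest: subgroup.mem_carrier)
  have "(\<Sum>C\<in>?I. of_real (cyclic_exponent G C) * ((\<Sum>g\<in>C. \<chi> g) / of_nat (card C))) =
      (\<Sum>C\<in>?I. \<Sum>g\<in>{g \<in> carrier G. g \<in> C}. of_real (?w C) * \<chi> g)"
    using sub by (intro sum.cong refl) (simp add: sum_distrib_left sum_divide_distrib)
  also have "\<dots> = (\<Sum>g\<in>carrier G. \<Sum>C | C \<in> ?I \<and> g \<in> C. of_real (?w C) * \<chi> g)"
    by (rule sum.swap_restrict[OF finI fin])
  also have "\<dots> = (\<Sum>g\<in>carrier G. of_real (\<Sum>C | C \<in> ?I \<and> g \<in> C. ?w C) * \<chi> g)"
    by (simp add: sum_distrib_right)
  also have "\<dots> = (\<Sum>g\<in>carrier G. \<chi> g) / of_nat (card (carrier G))"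
    by (simp add: sum_cyclic_exponent_containing[OF fin] sum_divide_distrib)
  finally show ?thesis by simp
qed

end

section \<open>Spectra of covers\<close>

text \<open>Adjacency minus degree matrix, written as one sum over outgoing arcs so that a cover can
  be applied termwise; loops cancel.\<close>

definition neg_laplacian :: "('v, 'e) pre_digraph \<Rightarrow> 'v \<Rightarrow> 'v \<Rightarrow> complex" where
  "neg_laplacian X x y = (\<Sum>a\<in>out_arcs X x. of_bool (head X a = y) - of_bool (x = y))"

text \<open>
  The trace of \<open>A\<^sup>k P\<^sub>g\<close>, with \<open>A\<close> the negated Laplacian and \<open>P\<^sub>g\<close> the permutation matrix of \<open>g\<close>.
\<close>

definition twisted_trace :: "('w, 'd) pre_digraph \<Rightarrow> ('g \<Rightarrow> 'w \<Rightarrow> 'w) \<Rightarrow> nat \<Rightarrow> 'g \<Rightarrow> complex" where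
  "twisted_trace Y \<phi> k g = (\<Sum>w\<in>verts Y. mpow (verts Y) (neg_laplacian Y) k w (\<phi> g w))"

context graph_cover
begin

abbreviation ram :: "'w \<Rightarrow> nat" where
  "ram \<equiv> ramification_index Y X \<pi>V \<pi>E"

definition vert_fiber :: "'v \<Rightarrow> 'w set" where
  "vert_fiber v = {w \<in> verts Y. \<pi>V w = v}"

lemma finite_vert_fiber: "finite (vert_fiber v)"
  by (simp add: vert_fiber_def)

lemma vert_fiber_nonempty: "v \<in> verts X \<Longrightarrow> vert_fiber v \<noteq> {}"
  unfolding vert_fiber_def by (auto simp flip: surj_verts)

lemma ramification_index_unique:
  assumes "is_ramification_index Y X \<pi>V \<pi>E w m" "is_ramification_index Y X \<pi>V \<pi>E w m'"
  shows "m = m'"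
proof (cases "out_arcs X (\<pi>V w) = {}")
  case False
  then obtain a where "a \<in> out_arcs X (\<pi>V w)" by blast
  then show ?thesis using assms unfolding is_ramification_index_def by metis
qed (use assms in \<open>simp add: is_ramification_index_def\<close>)

lemma is_ramification_index_ram:
  assumes "w \<in> verts Y" shows "is_ramification_index Y X \<pi>V \<pi>E w (ram w)"
proof -
  obtain m where m: "is_ramification_index Y X \<pi>V \<pi>E w m" using ramification[OF assms] by blast
  then show ?thesis
    unfolding ramification_index_def by (rule theI) (rule ramification_index_unique[OF _ m])
qed

lemma ram_eqI: "is_ramification_index Y X \<pi>V \<pi>E w m \<Longrightarrow> ram w = m"
  unfolding ramification_index_def by (rule the_equality, assumption) (rule ramification_index_unique)

lemma sum_out_arcs:
  fixes F :: "'e \<Rightarrow> 'b :: comm_semiring_1"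
  assumes w: "w \<in> verts Y"
  shows "(\<Sum>e\<in>out_arcs Y w. F (\<pi>E e)) = of_nat (ram w) * (\<Sum>a\<in>out_arcs X (\<pi>V w). F a)"
proof -
  have sub: "\<pi>E ` out_arcs Y w \<subseteq> out_arcs X (\<pi>V w)"
    using surj_arcs map_tail by auto
  have "(\<Sum>e\<in>out_arcs Y w. F (\<pi>E e)) =
      (\<Sum>a\<in>out_arcs X (\<pi>V w). \<Sum>e\<in>{e \<in> out_arcs Y w. \<pi>E e = a}. F (\<pi>E e))"
    by (rule sum.group[symmetric, OF Y.finite_out_arcs X.finite_out_arcs sub])
  also have "\<dots> = (\<Sum>a\<in>out_arcs X (\<pi>V w). of_nat (ram w) * F a)"
    using is_ramification_index_ram[OF w] by (intro sum.cong refl) (simp add: is_ramification_index_def)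
  finally show ?thesis by (simp add: sum_distrib_left)
qed

text \<open>The intertwining relation: on functions pulled back along \<open>\<pi>V\<close> the
  matrix of \<open>Y\<close> acts as that of \<open>X\<close>, scaled by the ramification
  index.\<close>

lemma sum_fiber_neg_laplacian:
  assumes w: "w \<in> verts Y" and v: "v \<in> verts X"
  shows "(\<Sum>w'\<in>vert_fiber v. neg_laplacian Y w w') = of_nat (ram w) * neg_laplacian X (\<pi>V w) v"
proof -
  have delta: "(\<Sum>w'\<in>vert_fiber v. of_bool (u = w')) = (of_bool (\<pi>V u = v) :: complex)" if "u \<in> verts Y" for u
  proof -
    have "(\<Sum>w'\<in>vert_fiber v. of_bool (u = w') :: complex) = (if u \<in> vert_fiber v then 1 else 0)"
      using finite_vert_fiber[of v] by (simp add: of_bool_def)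
    then show ?thesis using that by (simp add: vert_fiber_def)
  qed
  have "(\<Sum>w'\<in>vert_fiber v. neg_laplacian Y w w') =
      (\<Sum>e\<in>out_arcs Y w. \<Sum>w'\<in>vert_fiber v. of_bool (head Y e = w') - of_bool (w = w'))"
    unfolding neg_laplacian_def by (rule sum.swap)
  also have "\<dots> = (\<Sum>e\<in>out_arcs Y w. of_bool (head X (\<pi>E e) = v) - of_bool (\<pi>V w = v))"
  proof (rule sum.cong[OF refl])
    fix e assume e: "e \<in> out_arcs Y w"
    then have "head Y e \<in> verts Y" "head X (\<pi>E e) = \<pi>V (head Y e)"
      by (auto simp: map_head intro: Y.wellformed)
    then show "(\<Sum>w'\<in>vert_fiber v. of_bool (head Y e = w') - of_bool (w = w') :: complex) =
        of_bool (head X (\<pi>E e) = v) - of_bool (\<pi>V w = v)"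
      using delta w by (simp add: sum_subtractf)
  qed
  also have "\<dots> = of_nat (ram w) * neg_laplacian X (\<pi>V w) v"
    unfolding neg_laplacian_def by (rule sum_out_arcs[OF w])
  finally show ?thesis .
qed

lemma sum_fibers: "(\<Sum>v\<in>verts X. \<Sum>w\<in>vert_fiber v. F w) = (\<Sum>w\<in>verts Y. F w)"
  unfolding vert_fiber_def by (rule sum.group) (use surj_verts in auto)

end

lemma (in finite_connected_graph) reachable_all:
  assumes "x \<in> verts G" "y \<in> verts G"
  shows "x \<rightarrow>\<^sup>*\<^bsub>G\<^esub> y"
  using connected assms by (auto simp: connected_def strongly_connected_def reachable_mk_symmetric_eq[OF sym_arcs])

text \<open>Isolates the degenerate case in which the convention \<open>m = 1\<close> decides the
  ramification index: the graph is then a single point.\<close>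

lemma (in finite_connected_graph) no_out_arcs_trivial:
  assumes v: "v \<in> verts G" "out_arcs G v = {}"
  shows "verts G = {v}" "arcs G = {}"
proof -
  have "x = v" if "x \<in> verts G" for x
  proof -
    have "v \<rightarrow>\<^sup>*\<^bsub>G\<^esub> x" using reachable_all v that by blast
    then show ?thesis
    proof (induction rule: reachable_induct)
      case (step x y)
      then obtain a where "a \<in> arcs G" "tail G a = v" by (auto simp: arcs_ends_def arc_to_ends_def)
      then show ?case using v by (auto simp: out_arcs_def)
    qed simp
  qed
  then show verts: "verts G = {v}" using v by blast
  show "arcs G = {}"
  proof (rule ccontr)
    assume "arcs G \<noteq> {}"
    then obtain a where "a \<in> arcs G" by blast
    then have "a \<in> out_arcs G v" using verts tail_in_verts by force
    then show False using v by blast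
  qed
qed

section \<open>Orbits, stabilizers and sums over a group\<close>

lemma (in group_action) orbit_eq_iff:
  assumes "x \<in> E" "y \<in> E"
  shows "orbit G \<phi> x = orbit G \<phi> y \<longleftrightarrow> (\<exists>g\<in>carrier G. \<phi> g x = y)"
proof
  assume "orbit G \<phi> x = orbit G \<phi> y"
  then have "y \<in> orbit G \<phi> x" using orbit_refl[OF assms(2)] by simp
  then show "\<exists>g\<in>carrier G. \<phi> g x = y" by (auto simp: orbit_def)
next
  assume "\<exists>g\<in>carrier G. \<phi> g x = y"
  then have y: "y \<in> orbit G \<phi> x" by (auto simp: orbit_def)
  then have x: "x \<in> orbit G \<phi> y" using orbit_sym[OF assms] by blast
  have "\<And>z. z \<in> orbit G \<phi> x \<Longrightarrow> z \<in> E" "\<And>z. z \<in> orbit G \<phi> y \<Longrightarrow> z \<in> E"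
    using element_image assms by (auto simp: orbit_def)
  then show "orbit G \<phi> x = orbit G \<phi> y"
    using orbit_trans[OF assms(2) assms(1) _ x] orbit_trans[OF assms(1) assms(2) _ y] by blast
qed

text \<open>The elements carrying \<open>x\<close> to a fixed point of its orbit form a coset of the
  stabilizer, so each point of the orbit is hit equally often.\<close>

lemma (in group_action) sum_over_group:
  fixes F :: "'c \<Rightarrow> 'd :: comm_semiring_1"
  assumes fin: "finite (carrier G)" and x: "x \<in> E"
  shows "(\<Sum>g\<in>carrier G. F (\<phi> g x)) = of_nat (card (stabilizer G \<phi> x)) * (\<Sum>y\<in>orbit G \<phi> x. F y)"
proof -
  interpret G: group G using group_hom group_hom.axioms(1) by blast
  let ?S = "stabilizer G \<phi> x"
  have orb: "orbit G \<phi> x = (\<lambda>g. \<phi> g x) ` carrier G" by (auto simp: orbit_def)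
  have card: "card {g \<in> carrier G. \<phi> g x = y} = card ?S" if y: "y \<in> orbit G \<phi> x" for y
  proof -
    obtain h where h: "h \<in> carrier G" "\<phi> h x = y" using y by (auto simp: orbit_def)
    have "bij_betw (\<lambda>s. h \<otimes> s) ?S {g \<in> carrier G. \<phi> g x = y}"
    proof (rule bij_betw_byWitness[where f' = "\<lambda>g. inv h \<otimes> g"])
      show "\<forall>s\<in>?S. inv h \<otimes> (h \<otimes> s) = s"
        using h by (auto simp: stabilizer_def G.m_assoc[symmetric])
      show "\<forall>g\<in>{g \<in> carrier G. \<phi> g x = y}. h \<otimes> (inv h \<otimes> g) = g"
        using h by (auto simp: G.m_assoc[symmetric])
      show "(\<lambda>s. h \<otimes> s) ` ?S \<subseteq> {g \<in> carrier G. \<phi> g x = y}"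
        using h x composition_rule[OF x] by (auto simp: stabilizer_def)
      have "\<phi> (inv h) y = x" using orbit_sym_aux[OF h(1) x] h(2) by blast
      then show "(\<lambda>g. inv h \<otimes> g) ` {g \<in> carrier G. \<phi> g x = y} \<subseteq> ?S"
        using h x composition_rule[OF x] by (auto simp: stabilizer_def)
    qed
    then show ?thesis using bij_betw_same_card by fastforce
  qed
  have "(\<Sum>g\<in>carrier G. F (\<phi> g x)) = (\<Sum>y\<in>orbit G \<phi> x. \<Sum>g\<in>{g \<in> carrier G. \<phi> g x = y}. F (\<phi> g x))"
    unfolding orb by (rule sum.group[symmetric]) (use fin in auto)
  also have "\<dots> = (\<Sum>y\<in>orbit G \<phi> x. of_nat (card ?S) * F y)"
    using card by (intro sum.cong refl) simp
  finally show ?thesis by (simp add: sum_distrib_left)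
qed

section \<open>Ramification, traces and spectrum of a Galois cover\<close>

context galois_cover
begin

lemma group_G: "group G"
  using V.group_hom group_hom.axioms(1) by blast

abbreviation base_ram :: "'v \<Rightarrow> nat" where
  "base_ram \<equiv> base_ramification_index Y X \<pi>V \<pi>E"

lemma vert_fiber_eq_orbit:
  assumes "w \<in> verts Y" shows "vert_fiber (\<pi>V w) = orbit G \<phi>V w"
proof (intro equalityI subsetI)
  fix w' assume "w' \<in> vert_fiber (\<pi>V w)"
  then show "w' \<in> orbit G \<phi>V w"
    using vert_fiber_transitive[OF assms, of w'] by (auto simp: vert_fiber_def orbit_def)
next
  fix w' assume "w' \<in> orbit G \<phi>V w"
  then obtain g where "g \<in> carrier G" "w' = \<phi>V g w" by (auto simp: orbit_def)
  then show "w' \<in> vert_fiber (\<pi>V w)"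
    using vert_fiber_stable[of g w] V.element_image[of g w w'] assms by (simp add: vert_fiber_def)
qed

text \<open>\<open>\<phi>E g\<close> matches the arcs leaving \<open>w\<close> with those leaving
  \<open>\<phi>V g w\<close> over the same arcs of \<open>X\<close>.\<close>

lemma ram_invariant:
  assumes g: "g \<in> carrier G" and w: "w \<in> verts Y"
  shows "ram (\<phi>V g w) = ram w"
proof (rule ram_eqI)
  interpret G: group G by (rule group_G)
  have card: "card {e \<in> out_arcs Y (\<phi>V g w). \<pi>E e = a} = card {e \<in> out_arcs Y w. \<pi>E e = a}" for a
  proof -
    have "bij_betw (\<phi>E g) {e \<in> out_arcs Y w. \<pi>E e = a} {e \<in> out_arcs Y (\<phi>V g w). \<pi>E e = a}"
    proof (rule bij_betw_byWitness[where f' = "\<phi>E (inv\<^bsub>G\<^esub> g)"])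
      have inv: "\<phi>E (inv\<^bsub>G\<^esub> g) (\<phi>E g e) = e" "\<phi>E g (\<phi>E (inv\<^bsub>G\<^esub> g) e) = e" if "e \<in> arcs Y" for e
        using E.orbit_sym_aux[OF g that refl] E.orbit_sym_aux[of "inv\<^bsub>G\<^esub> g" e, OF _ that refl] g by auto
      show "\<forall>e\<in>{e \<in> out_arcs Y w. \<pi>E e = a}. \<phi>E (inv\<^bsub>G\<^esub> g) (\<phi>E g e) = e"
        and "\<forall>e\<in>{e \<in> out_arcs Y (\<phi>V g w). \<pi>E e = a}. \<phi>E g (\<phi>E (inv\<^bsub>G\<^esub> g) e) = e"
        using inv by auto
      show "\<phi>E g ` {e \<in> out_arcs Y w. \<pi>E e = a} \<subseteq> {e \<in> out_arcs Y (\<phi>V g w). \<pi>E e = a}"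
        using g E.element_image[OF g] by (auto simp: act_tail arc_fiber_stable)
      have "\<phi>V (inv\<^bsub>G\<^esub> g) (\<phi>V g w) = w" using V.orbit_sym_aux[OF g w refl] .
      then show "\<phi>E (inv\<^bsub>G\<^esub> g) ` {e \<in> out_arcs Y (\<phi>V g w). \<pi>E e = a} \<subseteq> {e \<in> out_arcs Y w. \<pi>E e = a}"
        using g E.element_image[of "inv\<^bsub>G\<^esub> g"] by (auto simp: act_tail arc_fiber_stable)
    qed
    then show ?thesis by (rule bij_betw_same_card[symmetric])
  qed
  show "is_ramification_index Y X \<pi>V \<pi>E (\<phi>V g w) (ram w)"
    using is_ramification_index_ram[OF w] vert_fiber_stable[OF g w]
    unfolding is_ramification_index_def card by simp
qed

text \<open>Transitivity on vertex fibres makes the choice inside \<open>base_ram\<close>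
  harmless.\<close>

lemma base_ram_eq:
  assumes w: "w \<in> verts Y" shows "base_ram (\<pi>V w) = ram w"
proof -
  define w' where "w' = (SOME w'. w' \<in> verts Y \<and> \<pi>V w' = \<pi>V w)"
  have "w' \<in> verts Y \<and> \<pi>V w' = \<pi>V w"
    unfolding w'_def by (rule someI[of _ w]) (use w in simp)
  then obtain g where "g \<in> carrier G" "w' = \<phi>V g w"
    using vert_fiber_transitive[OF w, of w'] by auto
  then show ?thesis
    using ram_invariant[OF _ w] by (simp add: base_ramification_index_def w'_def)
qed

lemma base_ram_pos:
  assumes "v \<in> verts X" shows "base_ram v > 0"
proof -
  obtain w where "w \<in> verts Y" "\<pi>V w = v" using vert_fiber_nonempty[OF assms] by (auto simp: vert_fiber_def)
  then show ?thesis
    using base_ram_eq[of w] is_ramification_index_ram[of w] by (simp add: is_ramification_index_def)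
qed

text \<open>Counts the arcs above an arc leaving \<open>v\<close> in two ways: the group acts simply
  transitively on them, and every vertex above \<open>v\<close> is the tail of
  \<open>base_ram v\<close> of them.\<close>

lemma base_ram_mult_card_fiber:
  assumes v: "v \<in> verts X"
  shows "base_ram v * card (vert_fiber v) = card (carrier G)"
proof (cases "out_arcs X v = {}")
  case True
  obtain w where w: "w \<in> verts Y" "\<pi>V w = v" using vert_fiber_nonempty[OF v] by (auto simp: vert_fiber_def)
  have X: "arcs X = {}" using X.no_out_arcs_trivial(2)[OF v True] .
  then have Y: "arcs Y = {}" using surj_arcs by auto
  then have "out_arcs Y w = {}" by auto
  then have verts: "verts Y = {w}" using Y.no_out_arcs_trivial(1)[OF w(1)] by blast
  have "base_ram v = 1"
    using base_ram_eq[OF w(1)] is_ramification_index_ram[OF w(1)] True w(2)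
    by (simp add: is_ramification_index_def)
  moreover have "vert_fiber v = {w}" using verts w by (auto simp: vert_fiber_def)
  moreover have "carrier G = {\<one>\<^bsub>G\<^esub>}"
  proof -
    interpret G: group G by (rule group_G)
    \<comment> \<open>Without arcs, freeness gives no information and faithfulness takes over:
      \<open>Y\<close> is a single point, and since the actions are by extensional maps, all group
      elements give equal functions.\<close>
    have trivial: "\<phi>V g = \<phi>V \<one>\<^bsub>G\<^esub> \<and> \<phi>E g = \<phi>E \<one>\<^bsub>G\<^esub>" if g: "g \<in> carrier G" for g
    proof
      show "\<phi>V g = \<phi>V \<one>\<^bsub>G\<^esub>"
      proof (rule extensionalityI[of _ "verts Y"])
        show "\<phi>V g \<in> extensional (verts Y)" "\<phi>V \<one>\<^bsub>G\<^esub> \<in> extensional (verts Y)"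
          using V.bij_prop0 g by (auto simp: Bij_def)
        show "\<phi>V g u = \<phi>V \<one>\<^bsub>G\<^esub> u" if "u \<in> verts Y" for u
          using V.element_image[OF g that refl] V.element_image[OF G.one_closed that refl] verts by simp
      qed
      show "\<phi>E g = \<phi>E \<one>\<^bsub>G\<^esub>"
        by (rule extensionalityI[of _ "arcs Y"]) (use E.bij_prop0 g Y in \<open>auto simp: Bij_def\<close>)
    qed
    have "g = \<one>\<^bsub>G\<^esub>" if g: "g \<in> carrier G" for g
      by (rule inj_onD[OF faithful _ g G.one_closed]) (use trivial[OF g] in simp)
    then show ?thesis by blast
  qed
  ultimately show ?thesis by simp
next
  case False
  then obtain b where "b \<in> out_arcs X v" by blast
  then have b: "b \<in> arcs X" "tail X b = v" by simp_all
  then have "b \<in> \<pi>E ` arcs Y" using surj_arcs by simp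
  then obtain e where e: "e \<in> arcs Y" "\<pi>E e = b" by blast
  interpret G: group G by (rule group_G)
  let ?F = "{e \<in> arcs Y. \<pi>E e = b}"
  have "bij_betw (\<lambda>g. \<phi>E g e) (carrier G) ?F"
    unfolding bij_betw_def
  proof
    show "inj_on (\<lambda>g. \<phi>E g e) (carrier G)"
    proof (rule inj_onI)
      fix g h assume g: "g \<in> carrier G" and h: "h \<in> carrier G" and eq: "\<phi>E g e = \<phi>E h e"
      have "\<phi>E (inv\<^bsub>G\<^esub> h \<otimes>\<^bsub>G\<^esub> g) e = \<phi>E (inv\<^bsub>G\<^esub> h) (\<phi>E g e)"
        by (rule E.composition_rule[OF e(1) G.inv_closed[OF h] g])
      also have "\<dots> = e" unfolding eq by (rule E.orbit_sym_aux[OF h e(1) refl])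
      finally have "inv\<^bsub>G\<^esub> h \<otimes>\<^bsub>G\<^esub> g = \<one>\<^bsub>G\<^esub>" using arc_fiber_free[OF _ e(1)] g h by simp
      then show "g = h" using g h by (metis G.inv_closed G.inv_equality G.inv_inv)
    qed
    show "(\<lambda>g. \<phi>E g e) ` carrier G = ?F"
    proof (intro equalityI subsetI)
      fix e' assume "e' \<in> (\<lambda>g. \<phi>E g e) ` carrier G"
      then show "e' \<in> ?F"
        using arc_fiber_stable[OF _ e(1)] E.element_image[OF _ e(1) refl] e(2) by auto
    next
      fix e' assume "e' \<in> ?F"
      then show "e' \<in> (\<lambda>g. \<phi>E g e) ` carrier G"
        using arc_fiber_transitive[OF e(1), of e'] e(2) by auto
    qed
  qed
  then have "card (carrier G) = card ?F" by (rule bij_betw_same_card)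
  also have "\<dots> = (\<Sum>w\<in>vert_fiber v. card {e \<in> out_arcs Y w. \<pi>E e = b})"
  proof -
    have "(\<Sum>w\<in>vert_fiber v. \<Sum>e\<in>{e \<in> ?F. tail Y e = w}. 1) = (\<Sum>e\<in>?F. 1 :: nat)"
      by (rule sum.group) (use map_tail b in \<open>auto simp: finite_vert_fiber vert_fiber_def\<close>)
    moreover have "{e \<in> ?F. tail Y e = w} = {e \<in> out_arcs Y w. \<pi>E e = b}" for w by auto
    ultimately show ?thesis by simp
  qed
  also have "\<dots> = (\<Sum>w\<in>vert_fiber v. base_ram v)"
  proof (rule sum.cong[OF refl])
    fix w assume "w \<in> vert_fiber v"
    then have w: "w \<in> verts Y" "\<pi>V w = v" by (auto simp: vert_fiber_def)
    have "b \<in> out_arcs X (\<pi>V w)" using b w by simp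
    then show "card {e \<in> out_arcs Y w. \<pi>E e = b} = base_ram v"
      using is_ramification_index_ram[OF w(1)] base_ram_eq[OF w(1)] w(2)
      by (simp add: is_ramification_index_def)
  qed
  finally show ?thesis by (simp add: mult.commute)
qed

text \<open>The orbit-stabilizer theorem and \<open>base_ram_mult_card_fiber\<close> identify the
  ramification index with the order of the stabilizer.\<close>

lemma sum_over_group_action:
  fixes F :: "'w \<Rightarrow> 'b :: comm_semiring_1"
  assumes fin: "finite (carrier G)" and w: "w \<in> verts Y"
  shows "(\<Sum>g\<in>carrier G. F (\<phi>V g w)) = of_nat (base_ram (\<pi>V w)) * (\<Sum>w'\<in>vert_fiber (\<pi>V w). F w')"
proof -
  have v: "\<pi>V w \<in> verts X" using w surj_verts by blast
  have "card (orbit G \<phi>V w) * card (stabilizer G \<phi>V w) = card (carrier G)"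
    using V.orbit_stabilizer_theorem[OF w] by (simp add: Coset.order_def)
  also have "\<dots> = base_ram (\<pi>V w) * card (orbit G \<phi>V w)"
    using base_ram_mult_card_fiber[OF v] vert_fiber_eq_orbit[OF w] by simp
  finally have "card (stabilizer G \<phi>V w) = base_ram (\<pi>V w)"
    using vert_fiber_nonempty[OF v] finite_vert_fiber[of "\<pi>V w"] vert_fiber_eq_orbit[OF w]
    by (simp add: card_gt_0_iff)
  then show ?thesis using V.sum_over_group[OF fin w, of F] vert_fiber_eq_orbit[OF w] by simp
qed

text \<open>Iterates \<open>sum_fiber_neg_laplacian\<close>: summing over a fibre pushes powers of
  the Laplacian of \<open>Y\<close> down to powers of the weighted Laplacian of
  \<open>X\<close>.\<close>

lemma sum_fiber_mpow:
  assumes w: "w \<in> verts Y" and "v \<in> verts X"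
  shows "(\<Sum>w'\<in>vert_fiber v. mpow (verts Y) (neg_laplacian Y) k w w') =
    mpow (verts X) (\<lambda>x y. of_nat (base_ram x) * neg_laplacian X x y) k (\<pi>V w) v"
  using assms(2)
proof (induction k arbitrary: v)
  case 0
  have "(\<Sum>w'\<in>vert_fiber v. of_bool (w = w') :: complex) = (if w \<in> vert_fiber v then 1 else 0)"
    using finite_vert_fiber[of v] by (simp add: of_bool_def)
  then show ?case using w by (simp add: vert_fiber_def)
next
  case (Suc k)
  let ?K = "mpow (verts Y) (neg_laplacian Y) k w"
  let ?B = "\<lambda>x y. of_nat (base_ram x) * neg_laplacian X x y"
  have "(\<Sum>w'\<in>vert_fiber v. mpow (verts Y) (neg_laplacian Y) (Suc k) w w') =
      (\<Sum>z\<in>verts Y. ?K z * (\<Sum>w'\<in>vert_fiber v. neg_laplacian Y z w'))"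
    by (simp add: sum.swap[of _ "verts Y"] sum_distrib_left)
  also have "\<dots> = (\<Sum>z\<in>verts Y. ?K z * ?B (\<pi>V z) v)"
    using sum_fiber_neg_laplacian[OF _ Suc.prems] base_ram_eq by (intro sum.cong refl) simp
  also have "\<dots> = (\<Sum>u\<in>verts X. \<Sum>z\<in>vert_fiber u. ?K z * ?B (\<pi>V z) v)"
    by (rule sum_fibers[symmetric])
  also have "\<dots> = (\<Sum>u\<in>verts X. (\<Sum>z\<in>vert_fiber u. ?K z) * ?B u v)"
    unfolding sum_distrib_right by (intro sum.cong refl) (simp add: vert_fiber_def)
  also have "\<dots> = (\<Sum>u\<in>verts X. mpow (verts X) ?B k (\<pi>V w) u * ?B u v)"
    using Suc.IH by simp
  finally show ?case by simp
qed

text \<open>Averaging over the group projects onto the invariant functions, that is, the functions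
  on \<open>verts X\<close>. In the double sum each \<open>v\<close> receives the weight
  \<open>base_ram v * card (vert_fiber v)\<close>, which is the group order.\<close>

lemma trace_mpow:
  assumes fin: "finite (carrier G)"
  shows "(\<Sum>v\<in>verts X. mpow (verts X) (\<lambda>x y. of_nat (base_ram x) * neg_laplacian X x y) k v v) =
    (\<Sum>g\<in>carrier G. twisted_trace Y \<phi>V k g) / of_nat (card (carrier G))"
proof -
  let ?K = "mpow (verts Y) (neg_laplacian Y) k"
  let ?T = "\<lambda>v. mpow (verts X) (\<lambda>x y. of_nat (base_ram x) * neg_laplacian X x y) k v v"
  have pos: "card (carrier G) > 0"
    using fin group.is_monoid[OF group_G] by (auto simp: card_gt_0_iff dest: monoid.one_closed)
  have "(\<Sum>g\<in>carrier G. \<Sum>w\<in>verts Y. ?K w (\<phi>V g w)) = (\<Sum>w\<in>verts Y. \<Sum>g\<in>carrier G. ?K w (\<phi>V g w))"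
    by (rule sum.swap)
  also have "\<dots> = (\<Sum>w\<in>verts Y. of_nat (base_ram (\<pi>V w)) * ?T (\<pi>V w))"
  proof (rule sum.cong[OF refl])
    fix w assume w: "w \<in> verts Y"
    then have "\<pi>V w \<in> verts X" using surj_verts by blast
    then show "(\<Sum>g\<in>carrier G. ?K w (\<phi>V g w)) = of_nat (base_ram (\<pi>V w)) * ?T (\<pi>V w)"
      by (simp only: sum_over_group_action[OF fin w] sum_fiber_mpow[OF w])
  qed
  also have "\<dots> = (\<Sum>v\<in>verts X. \<Sum>w\<in>vert_fiber v. of_nat (base_ram (\<pi>V w)) * ?T (\<pi>V w))"
    by (rule sum_fibers[symmetric])
  also have "\<dots> = (\<Sum>v\<in>verts X. \<Sum>w\<in>vert_fiber v. of_nat (base_ram v) * ?T v)"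
    by (intro sum.cong refl) (simp add: vert_fiber_def)
  also have "\<dots> = (\<Sum>v\<in>verts X. of_nat (card (carrier G)) * ?T v)"
    by (intro sum.cong refl) (simp add: mult.assoc[symmetric] mult.commute flip: base_ram_mult_card_fiber)
  also have "\<dots> = of_nat (card (carrier G)) * (\<Sum>v\<in>verts X. ?T v)"
    by (simp add: sum_distrib_left)
  finally show ?thesis using pos by (simp add: twisted_trace_def)
qed

text \<open>The list holds the eigenvalues of the weighted Laplacian of \<open>X\<close>, with power
  sums from \<open>trace_mpow\<close> and nonzero product from the matrix-tree theorem. The power
  sums refer only to \<open>Y\<close> and the acting group, so different quotients of
  \<open>Y\<close> can be compared.\<close>

lemma cover_spectrum:
  assumes fin: "finite (carrier G)"
  shows "\<exists>es. (\<forall>k. (\<Sum>e\<leftarrow>es. e ^ k) =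
      (\<Sum>g\<in>carrier G. twisted_trace Y \<phi>V k g) / of_nat (card (carrier G))) \<and>
    nonzero_norm_prod es = real (num_spanning_trees X \<iota>X) * (\<Prod>v\<in>verts X. real (base_ram v)) *
      real (card (verts Y)) / real (card (carrier G))"
proof -
  let ?V = "verts X" and ?n = "card (carrier G)"
  let ?B = "\<lambda>x y. of_nat (base_ram x) * neg_laplacian X x y :: complex"
  let ?P = "\<Prod>v\<in>?V. real (base_ram v)"
  obtain es where es: "det_on ?V (\<lambda>x y. of_bool (x = y) * [:0, 1:] - [:?B x y:]) = (\<Prod>e\<leftarrow>es. [:- e, 1:])"
    and pow: "\<And>k. (\<Sum>x\<in>?V. mpow ?V ?B k x x) = (\<Sum>e\<leftarrow>es. e ^ k)"
    using eigenvalue_list[OF X.finite_verts, of ?B] by blast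
  define p where "p = (\<Prod>e\<leftarrow>es. [:- e, 1:])"
  have ne: "?V \<noteq> {}" using X.connected by (auto simp: connected_def strongly_connected_def)
  have pos: "?n > 0"
    using fin group.is_monoid[OF group_G] by (auto simp: card_gt_0_iff dest: monoid.one_closed)
  have coeffs: "coeff p 0 = 0" "coeff p 1 =
      (\<Sum>r\<in>?V. of_nat (card (arborescences X r)) * (\<Prod>x\<in>?V - {r}. of_nat (base_ram x)))"
    using X.laplacian_char_poly_coeffs[OF ne, of "\<lambda>x. of_nat (base_ram x)"]
    unfolding p_def es[symmetric] neg_laplacian_def by auto
  \<comment> \<open>Omitting the factor at the root means dividing by \<open>base_ram r\<close>,
    that is, multiplying by the fibre size over the group order. Summed over all roots, the fibre
    sizes give \<open>card (verts Y)\<close>.\<close>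
  have fiber: "(\<Prod>x\<in>?V - {r}. real (base_ram x)) = ?P * real (card (vert_fiber r)) / real ?n" if "r \<in> ?V" for r
  proof -
    have "?P = real (base_ram r) * (\<Prod>x\<in>?V - {r}. real (base_ram x))"
      using that by (simp add: prod.remove)
    moreover have "real (base_ram r) * real (card (vert_fiber r)) = real ?n"
      using base_ram_mult_card_fiber[OF that] by (simp flip: of_nat_mult)
    ultimately show ?thesis using pos by (simp add: field_simps)
  qed
  have "coeff p 1 = of_real (\<Sum>r\<in>?V. real (num_spanning_trees X \<iota>X) * (\<Prod>x\<in>?V - {r}. real (base_ram x)))"
    unfolding coeffs by (simp add: X.card_arborescences)
  also have "(\<Sum>r\<in>?V. real (num_spanning_trees X \<iota>X) * (\<Prod>x\<in>?V - {r}. real (base_ram x))) =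
      real (num_spanning_trees X \<iota>X) * ?P * (\<Sum>r\<in>?V. real (card (vert_fiber r))) / real ?n"
    by (simp add: fiber sum_distrib_left sum_divide_distrib mult.assoc)
  also have "(\<Sum>r\<in>?V. real (card (vert_fiber r))) = real (card (verts Y))"
    using sum_fibers[of "\<lambda>_. 1 :: nat"] by (simp flip: of_nat_sum)
  finally have c1: "coeff p 1 = of_real (real (num_spanning_trees X \<iota>X) * ?P * real (card (verts Y)) / real ?n)" .
  have "verts Y \<noteq> {}" using ne surj_verts by auto
  \<comment> \<open>Positivity makes the linear coefficient nonzero, as
    \<open>nonzero_norm_prod_eq_coeff\<close> requires.\<close>
  then have cpos: "real (num_spanning_trees X \<iota>X) * ?P * real (card (verts Y)) / real ?n > 0"
    using pos X.num_spanning_trees_pos base_ram_pos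
    by (intro divide_pos_pos mult_pos_pos prod_pos) (auto simp: card_gt_0_iff)
  then have "coeff p 1 \<noteq> 0" unfolding c1 by (simp only: of_real_eq_0_iff)
  from nonzero_norm_prod_eq_coeff[OF p_def coeffs(1) this]
  have "nonzero_norm_prod es = real (num_spanning_trees X \<iota>X) * ?P * real (card (verts Y)) / real ?n"
    unfolding c1 using cpos by (simp only: norm_of_real abs_of_pos)
  with pow show ?thesis by (intro exI[of _ es]) (simp add: trace_mpow[OF fin])
qed

end

section \<open>Quotients by subgroups as Galois covers\<close>

text \<open>Brings every quotient under \<open>cover_spectrum\<close> with the same
  \<open>Y\<close>. Beyond equivariance, the main points are that no arc orbit is its own reverse
  and that ramification indices exist.\<close>

lemma (in galois_cover) quotient_galois_cover:
  assumes H: "subgroup H G"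
  shows "galois_cover (G\<lparr>carrier := H\<rparr>) Y \<iota>Y
    (quotient_graph G Y \<phi>V \<phi>E H) (quotient_arev G Y \<iota>Y \<phi>E H)
    (orbit (G\<lparr>carrier := H\<rparr>) \<phi>V) (orbit (G\<lparr>carrier := H\<rparr>) \<phi>E) \<phi>V \<phi>E"
proof -
  let ?K = "G\<lparr>carrier := H\<rparr>"
  define Q where "Q = quotient_graph G Y \<phi>V \<phi>E H"
  define i where "i = quotient_arev G Y \<iota>Y \<phi>E H"
  define oV where "oV = orbit ?K \<phi>V"
  define oE where "oE = orbit ?K \<phi>E"
  interpret KV: group_action ?K "verts Y" \<phi>V by (rule V.induced_action[OF H])
  interpret KE: group_action ?K "arcs Y" \<phi>E by (rule E.induced_action[OF H])
  have HG: "h \<in> carrier G" if "h \<in> H" for h using H that by (rule subgroup.mem_carrier)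
  have vQ: "verts Q = oV ` verts Y" and aQ: "arcs Q = oE ` arcs Y"
    by (auto simp: Q_def quotient_graph_def orbits_def oV_def oE_def)
  have oV_im: "oV w = (\<lambda>h. \<phi>V h w) ` H" and oE_im: "oE e = (\<lambda>h. \<phi>E h e) ` H" for w e
    by (auto simp: oV_def oE_def orbit_def)
  have tQ: "tail Q (oE e) = oV (tail Y e)" and hQ: "head Q (oE e) = oV (head Y e)"
    and iQ: "i (oE e) = oE (\<iota>Y e)" if e: "e \<in> arcs Y" for e
  proof -
    have "tail Q (oE e) = (\<lambda>h. tail Y (\<phi>E h e)) ` H" "head Q (oE e) = (\<lambda>h. head Y (\<phi>E h e)) ` H"
      by (simp_all add: Q_def quotient_graph_def oE_im image_image)
    then show "tail Q (oE e) = oV (tail Y e)" "head Q (oE e) = oV (head Y e)"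
      unfolding oV_im using act_tail act_head HG e by simp_all
    have "oE e \<in> orbits ?K (arcs Y) \<phi>E" using e by (auto simp: orbits_def oE_def)
    then have "i (oE e) = (\<lambda>h. \<iota>Y (\<phi>E h e)) ` H"
      by (simp add: i_def quotient_arev_def oE_im image_image)
    then show "i (oE e) = oE (\<iota>Y e)"
      unfolding oE_im using act_arev HG e by simp
  qed
  have eqV: "oV w = oV w' \<longleftrightarrow> (\<exists>h\<in>H. \<phi>V h w = w')" if "w \<in> verts Y" "w' \<in> verts Y" for w w'
    using KV.orbit_eq_iff[OF that] by (simp add: oV_def)
  have eqE: "oE e = oE e' \<longleftrightarrow> (\<exists>h\<in>H. \<phi>E h e = e')" if "e \<in> arcs Y" "e' \<in> arcs Y" for e e'
    using KE.orbit_eq_iff[OF that] by (simp add: oE_def)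
  have act_V: "\<phi>V h w \<in> verts Y" if "h \<in> H" "w \<in> verts Y" for h w
    using KV.element_image[of h w] that by simp
  have act_E: "\<phi>E h e \<in> arcs Y" if "h \<in> H" "e \<in> arcs Y" for h e
    using KE.element_image[of h e] that by simp
  have wfQ: "wf_digraph Q"
  proof
    fix a assume "a \<in> arcs Q"
    then obtain e where e: "e \<in> arcs Y" "a = oE e" using aQ by blast
    show "tail Q a \<in> verts Q" using e tQ vQ Y.tail_in_verts by simp
    show "head Q a \<in> verts Q" using e hQ vQ Y.head_in_verts by simp
  qed
  interpret Q: wf_digraph Q by (rule wfQ)
  have "bidirected_digraph Q i"
  proof (rule Q.bidirected_digraphI)
    fix a assume "a \<notin> arcs Q"
    then show "i a = a" by (simp add: i_def quotient_arev_def Q_def quotient_graph_def)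
  next
    fix a assume "a \<in> arcs Q"
    then obtain e where e: "e \<in> arcs Y" "a = oE e" using aQ by blast
    have e': "\<iota>Y e \<in> arcs Y" using e by simp
    show "i a \<noteq> a"
    proof
      \<comment> \<open>otherwise the image of \<open>e\<close> in \<open>X\<close> would be inverted\<close>
      assume "i a = a"
      then obtain h where h: "h \<in> H" "\<phi>E h e = \<iota>Y e" using eqE[OF e(1) e'] iQ e by auto
      then have "\<pi>E (\<iota>Y e) = \<pi>E e" using arc_fiber_stable[OF HG[OF h(1)] e(1)] by simp
      then have "\<iota>X (\<pi>E e) = \<pi>E e" using map_arev[OF e(1)] by simp
      then show False using surj_arcs e(1) X.arev_neq[of "\<pi>E e"] by blast
    qed
    show "i (i a) = a" using e e' iQ by simp
    show "tail Q (i a) = head Q a" using e e' iQ tQ hQ by simp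
  qed
  then interpret Q: bidirected_digraph Q i .
  have "fin_digraph Q" by unfold_locales (simp_all add: vQ aQ)
  moreover have "Digraph_Component.connected Q"
  proof -
    have reach: "oV x \<rightarrow>\<^sup>*\<^bsub>Q\<^esub> oV y" if "x \<rightarrow>\<^sup>*\<^bsub>Y\<^esub> y" for x y
      using that
    proof (induction rule: Y.reachable_induct)
      case base
      then show ?case using vQ by simp
    next
      case (step y z)
      then obtain e where e: "e \<in> arcs Y" "tail Y e = y" "head Y e = z"
        by (auto simp: arcs_ends_def arc_to_ends_def)
      then have "oE e \<in> arcs Q" "tail Q (oE e) = oV y" "head Q (oE e) = oV z"
        using aQ tQ hQ by auto
      then have "(oV y, oV z) \<in> arcs_ends Q" by (force simp: arcs_ends_def arc_to_ends_def)
      with step.IH show ?case by (rule Q.reachable_adj_trans)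
    qed
    have Y_ne: "verts Y \<noteq> {}" using Y.connected by (auto simp: connected_def strongly_connected_def)
    moreover have "x \<rightarrow>\<^sup>*\<^bsub>Q\<^esub> y" if "x \<in> verts Q" "y \<in> verts Q" for x y
      using that reach Y.reachable_all unfolding vQ by blast
    ultimately show ?thesis
      by (simp add: connected_def strongly_connected_def Q.reachable_mk_symmetric_eq[OF Q.sym_arcs] vQ)
  qed
  ultimately have fcg: "finite_connected_graph Q i"
    by (simp add: finite_connected_graph_def finite_connected_graph_axioms_def Q.bidirected_digraph)
  \<comment> \<open>The arcs at \<open>w\<close> over one arc of the quotient form a single free
    orbit of the stabilizer of \<open>w\<close> in \<open>H\<close>, whose order is therefore the
    index. If the image of \<open>w\<close> has no outgoing arcs, the index is 1 by
    convention.\<close>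
  have ram: "\<exists>m. is_ramification_index Y Q oV oE w m" if w: "w \<in> verts Y" for w
  proof (cases "out_arcs Q (oV w) = {}")
    case True
    then have "is_ramification_index Y Q oV oE w 1" by (simp add: is_ramification_index_def)
    then show ?thesis ..
  next
    case False
    let ?S = "stabilizer ?K \<phi>V w"
    have card: "card {e' \<in> out_arcs Y w. oE e' = a} = card ?S \<and> card ?S > 0"
      if a: "a \<in> out_arcs Q (oV w)" for a
    proof -
      obtain e0 where e0: "e0 \<in> arcs Y" "a = oE e0" using a aQ by auto
      then have "oV (tail Y e0) = oV w" using a tQ by simp
      \<comment> \<open>Moves the representative \<open>e0\<close> within its orbit so that it
        starts at \<open>w\<close>.\<close>
      then obtain h where h: "h \<in> H" "\<phi>V h (tail Y e0) = w"
        using eqV[of "tail Y e0" w] w e0 by auto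
      define e where "e = \<phi>E h e0"
      have e: "e \<in> arcs Y" "tail Y e = w" using h e0 act_E act_tail[OF HG[OF h(1)]] by (auto simp: e_def)
      have ae: "a = oE e" using eqE[OF e0(1) e(1)] h e0 by (auto simp: e_def)
      have "{e' \<in> out_arcs Y w. oE e' = a} = (\<lambda>g. \<phi>E g e) ` ?S"
      proof (intro equalityI subsetI)
        fix e' assume "e' \<in> {e' \<in> out_arcs Y w. oE e' = a}"
        then have e': "e' \<in> arcs Y" "tail Y e' = w" "oE e = oE e'" using ae by auto
        then obtain g where g: "g \<in> H" "\<phi>E g e = e'" using eqE[OF e(1) e'(1)] by blast
        then have "\<phi>V g w = w" using act_tail[OF HG[OF g(1)] e(1)] e e' by simp
        then show "e' \<in> (\<lambda>g. \<phi>E g e) ` ?S" using g by (auto simp: stabilizer_def)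
      next
        fix e' assume "e' \<in> (\<lambda>g. \<phi>E g e) ` ?S"
        then obtain g where g: "g \<in> H" "\<phi>V g w = w" "e' = \<phi>E g e" by (auto simp: stabilizer_def)
        then have e': "e' \<in> arcs Y" "tail Y e' = w"
          using act_E[OF g(1) e(1)] act_tail[OF HG[OF g(1)] e(1)] e by auto
        then have "oE e = oE e'" using eqE[OF e(1) e'(1)] g by blast
        then show "e' \<in> {e' \<in> out_arcs Y w. oE e' = a}" using e' ae by simp
      qed
      moreover have "inj_on (\<lambda>g. \<phi>E g e) ?S"
      proof (rule inj_onI)
        interpret G: group G by (rule group_G)
        fix g k assume "g \<in> ?S" "k \<in> ?S" and eq: "\<phi>E g e = \<phi>E k e"
        then have g: "g \<in> carrier G" and k: "k \<in> carrier G" by (auto simp: stabilizer_def HG)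
        have "\<phi>E (inv\<^bsub>G\<^esub> k \<otimes>\<^bsub>G\<^esub> g) e = \<phi>E (inv\<^bsub>G\<^esub> k) (\<phi>E g e)"
          by (rule E.composition_rule[OF e(1) G.inv_closed[OF k] g])
        also have "\<dots> = e" unfolding eq by (rule E.orbit_sym_aux[OF k e(1) refl])
        finally have "inv\<^bsub>G\<^esub> k \<otimes>\<^bsub>G\<^esub> g = \<one>\<^bsub>G\<^esub>" using arc_fiber_free[OF _ e(1)] g k by simp
        then show "g = k" using g k by (metis G.inv_closed G.inv_equality G.inv_inv)
      qed
      ultimately have c: "card {e' \<in> out_arcs Y w. oE e' = a} = card ?S" by (simp add: card_image)
      have "e \<in> {e' \<in> out_arcs Y w. oE e' = a}" using e ae by simp
      moreover have "finite {e' \<in> out_arcs Y w. oE e' = a}"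
        by (rule finite_subset[OF _ Y.finite_out_arcs[of w]]) blast
      ultimately show ?thesis using c by (metis card_gt_0_iff empty_iff)
    qed
    then have "is_ramification_index Y Q oV oE w (card ?S)"
      using False unfolding is_ramification_index_def by blast
    then show ?thesis ..
  qed
  interpret QY: graph_cover Y \<iota>Y Q i oV oE
    using fcg Y.finite_connected_graph_axioms
    by (simp add: graph_cover_def graph_cover_axioms_def vQ aQ tQ hQ iQ ram)
  have "galois_cover ?K Y \<iota>Y Q i oV oE \<phi>V \<phi>E"
  proof
    show "tail Y (\<phi>E g e) = \<phi>V g (tail Y e)" "head Y (\<phi>E g e) = \<phi>V g (head Y e)"
      "\<iota>Y (\<phi>E g e) = \<phi>E g (\<iota>Y e)" if "g \<in> carrier ?K" "e \<in> arcs Y" for g e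
      using that HG act_tail act_head act_arev by simp_all
    show "inj_on (\<lambda>g. (\<phi>V g, \<phi>E g)) (carrier ?K)"
      by (rule inj_on_subset[OF faithful]) (use HG in auto)
    show "oV (\<phi>V g w) = oV w" if "g \<in> carrier ?K" "w \<in> verts Y" for g w
      using eqV[of w "\<phi>V g w"] act_V that by auto
    show "oE (\<phi>E g e) = oE e" if "g \<in> carrier ?K" "e \<in> arcs Y" for g e
      using eqE[of e "\<phi>E g e"] act_E that by auto
    show "\<exists>g\<in>carrier ?K. \<phi>V g w = w'" if "w \<in> verts Y" "w' \<in> verts Y" "oV w = oV w'" for w w'
      using eqV that by simp
    show "\<exists>g\<in>carrier ?K. \<phi>E g e = e'" if "e \<in> arcs Y" "e' \<in> arcs Y" "oE e = oE e'" for e e'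
      using eqE that by simp
    show "g = \<one>\<^bsub>?K\<^esub>" if "g \<in> carrier ?K" "e \<in> arcs Y" "\<phi>E g e = e" for g e
      using arc_fiber_free[of g e] HG that by simp
  qed
  then show ?thesis unfolding Q_def i_def oV_def oE_def .
qed

section \<open>Combining the spectra of all cyclic quotients\<close>

theorem theorem1p2:
  fixes G :: "('g, 'm) monoid_scheme"
    and Y :: "('w, 'd) pre_digraph" and \<iota>Y :: "'d \<Rightarrow> 'd"
    and X :: "('v, 'e) pre_digraph" and \<iota>X :: "'e \<Rightarrow> 'e"
    and \<pi>V :: "'w \<Rightarrow> 'v" and \<pi>E :: "'d \<Rightarrow> 'e"
    and \<phi>V :: "'g \<Rightarrow> 'w \<Rightarrow> 'w" and \<phi>E :: "'g \<Rightarrow> 'd \<Rightarrow> 'd"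
  assumes "group G" and "finite (carrier G)"
    and "galois_cover G Y \<iota>Y X \<iota>X \<pi>V \<pi>E \<phi>V \<phi>E"
  shows "real (num_spanning_trees X \<iota>X) =
    (\<Prod>C \<in> cyclic_subgroups G.
       (real (subgroup_index G C) *
          real (num_spanning_trees (quotient_graph G Y \<phi>V \<phi>E C) (quotient_arev G Y \<iota>Y \<phi>E C)) /
        ramification_factor G Y X \<pi>V \<pi>E \<phi>V \<phi>E C)
       powr cyclic_exponent G C)"
proof -
  interpret G: group G by fact
  interpret galois_cover G Y \<iota>Y X \<iota>X \<pi>V \<pi>E \<phi>V \<phi>E by fact
  let ?I = "cyclic_subgroups G" and ?a = "cyclic_exponent G"
  let ?Q = "quotient_graph G Y \<phi>V \<phi>E" and ?i = "quotient_arev G Y \<iota>Y \<phi>E"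
  let ?m = "\<lambda>C. base_ramification_index Y (?Q C)
    (orbit (G\<lparr>carrier := C\<rparr>) \<phi>V) (orbit (G\<lparr>carrier := C\<rparr>) \<phi>E)"
  let ?n = "real (card (carrier G))" and ?N = "real (card (verts Y))"
  let ?tr = "twisted_trace Y \<phi>V"
  note fin = \<open>finite (carrier G)\<close>
  have finI: "finite ?I" using fin by (simp add: G.cyclic_subgroups_eq)
  obtain es0 where pow0: "\<And>k. (\<Sum>e\<leftarrow>es0. e ^ k) = (\<Sum>g\<in>carrier G. ?tr k g) / of_nat (card (carrier G))"
    and norm0: "nonzero_norm_prod es0 =
      real (num_spanning_trees X \<iota>X) * (\<Prod>v\<in>verts X. real (base_ram v)) * ?N / ?n"
    using cover_spectrum[OF fin] by blast
  have "\<exists>es. (\<forall>k. (\<Sum>e\<leftarrow>es. e ^ k) = (\<Sum>g\<in>C. ?tr k g) / of_nat (card C)) \<and>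
      nonzero_norm_prod es = real (num_spanning_trees (?Q C) (?i C)) *
        (\<Prod>x\<in>verts (?Q C). real (?m C x)) * ?N / real (card C) \<and>
      (\<Prod>x\<in>verts (?Q C). real (?m C x)) > 0"
    if C: "C \<in> ?I" for C
  proof -
    have sub: "subgroup C G" using C by (simp add: cyclic_subgroups_def)
    interpret C: galois_cover "G\<lparr>carrier := C\<rparr>" Y \<iota>Y "?Q C" "?i C"
      "orbit (G\<lparr>carrier := C\<rparr>) \<phi>V" "orbit (G\<lparr>carrier := C\<rparr>) \<phi>E" \<phi>V \<phi>E
      by (rule quotient_galois_cover[OF sub])
    have "finite (carrier (G\<lparr>carrier := C\<rparr>))"
      using fin subgroup.subset[OF sub] by (simp add: finite_subset)
    from C.cover_spectrum[OF this]
    have "\<exists>es. (\<forall>k. (\<Sum>e\<leftarrow>es. e ^ k) = (\<Sum>g\<in>C. ?tr k g) / of_nat (card C)) \<and>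
        nonzero_norm_prod es = real (num_spanning_trees (?Q C) (?i C)) *
          (\<Prod>x\<in>verts (?Q C). real (?m C x)) * ?N / real (card C)"
      by simp
    moreover have "(\<Prod>x\<in>verts (?Q C). real (?m C x)) > 0"
      using C.base_ram_pos by (intro prod_pos) simp
    ultimately show ?thesis by blast
  qed
  then obtain es where pow: "\<And>C k. C \<in> ?I \<Longrightarrow> (\<Sum>e\<leftarrow>es C. e ^ k) = (\<Sum>g\<in>C. ?tr k g) / of_nat (card C)"
    and norm: "\<And>C. C \<in> ?I \<Longrightarrow> nonzero_norm_prod (es C) = real (num_spanning_trees (?Q C) (?i C)) *
        (\<Prod>x\<in>verts (?Q C). real (?m C x)) * ?N / real (card C)"
    and m_pos: "\<And>C. C \<in> ?I \<Longrightarrow> (\<Prod>x\<in>verts (?Q C). real (?m C x)) > 0"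
    by metis
  \<comment> \<open>Artin induction relates the power sums linearly;
    \<open>nonzero_norm_prod_powr\<close> turns this into a multiplicative relation.\<close>
  have prod: "nonzero_norm_prod es0 = (\<Prod>C\<in>?I. nonzero_norm_prod (es C) powr ?a C)"
  proof (rule nonzero_norm_prod_powr[OF finI])
    fix k show "(\<Sum>e\<leftarrow>es0. e ^ k) = (\<Sum>C\<in>?I. of_real (?a C) * (\<Sum>e\<leftarrow>es C. e ^ k))"
      using G.average_eq_sum_cyclic_averages[OF fin, of "?tr k"] by (simp add: pow0 pow)
  qed
  have card_pos: "card C > 0" if "C \<in> ?I" for C
  proof -
    have C: "subgroup C G" using that by (simp add: cyclic_subgroups_def)
    then show ?thesis
      using subgroup.one_closed[OF C] finite_subset[OF subgroup.subset[OF C] fin] by (auto simp: card_gt_0_iff)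
  qed
  have n_pos: "?n > 0" using fin G.one_closed by (auto simp: card_gt_0_iff)
  \<comment> \<open>The averaging identity for the constant function 1. It allows the common factor
    \<open>c\<close> to be distributed over the product.\<close>
  have sum_a: "(\<Sum>C\<in>?I. ?a C) = 1"
  proof -
    have "(\<Sum>C\<in>?I. ?a C) = (\<Sum>C\<in>?I. ?a C * (real (card C) / real (card C)))"
      by (intro sum.cong refl) (use card_pos in force)
    also have "\<dots> = 1"
      using G.average_eq_sum_cyclic_averages[OF fin, of "\<lambda>_. 1 :: real"] n_pos by simp
    finally show ?thesis .
  qed
  define P where "P = (\<Prod>v\<in>verts X. real (base_ram v))"
  have P: "P > 0" unfolding P_def using base_ram_pos by (intro prod_pos) simp
  have Y_ne: "verts Y \<noteq> {}" using Y.connected by (auto simp: connected_def strongly_connected_def)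
  then have N: "?N > 0" by (simp add: card_gt_0_iff)
  \<comment> \<open>The factor that turns \<open>nonzero_norm_prod es0\<close> into the tree number
    of \<open>X\<close>. Since the index of \<open>C\<close> is the group order over
    \<open>card C\<close>, the same factor turns \<open>nonzero_norm_prod (es C)\<close> into the
    base belonging to \<open>C\<close>.\<close>
  define c where "c = ?n / (?N * P)"
  have c: "c > 0" unfolding c_def using n_pos N P by simp
  have base: "real (subgroup_index G C) * real (num_spanning_trees (?Q C) (?i C)) /
      ramification_factor G Y X \<pi>V \<pi>E \<phi>V \<phi>E C = c * nonzero_norm_prod (es C)" if C: "C \<in> ?I" for C
  proof -
    have "real (subgroup_index G C) * real (card C) = ?n"
      using G.subgroup_index_mult_card[OF fin, of C] C by (simp add: cyclic_subgroups_def flip: of_nat_mult)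
    then have "real (subgroup_index G C) = ?n / real (card C)"
      using card_pos[OF C] by (simp add: field_simps)
    then show ?thesis
      using Y_ne N P card_pos[OF C] m_pos[OF C]
      by (simp add: norm[OF C] c_def ramification_factor_def P_def[symmetric] field_simps)
  qed
  have "real (num_spanning_trees X \<iota>X) = c * nonzero_norm_prod es0"
    using Y_ne n_pos N P by (simp add: norm0 c_def P_def[symmetric] field_simps)
  also have "\<dots> = c powr (\<Sum>C\<in>?I. ?a C) * (\<Prod>C\<in>?I. nonzero_norm_prod (es C) powr ?a C)"
    using c by (simp add: sum_a prod)
  also have "\<dots> = (\<Prod>C\<in>?I. c powr ?a C * nonzero_norm_prod (es C) powr ?a C)"
    using c finI by (simp add: powr_sum prod.distrib)
  also have "\<dots> = (\<Prod>C\<in>?I. (c * nonzero_norm_prod (es C)) powr ?a C)"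
    using c nonzero_norm_prod_pos by (simp add: powr_mult less_imp_le)
  also have "\<dots> = (\<Prod>C\<in>?I. (real (subgroup_index G C) * real (num_spanning_trees (?Q C) (?i C)) /
      ramification_factor G Y X \<pi>V \<pi>E \<phi>V \<phi>E C) powr ?a C)"
    by (intro prod.cong refl) (simp only: base)
  finally show ?thesis .
qed

end
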